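(* For each $*\in\{\mathrm{icx},\mathrm{cx},\mathrm{sl}\}$, the comparability set $$\mathcal{P}_*=\bigl\{(A,B)\in\mathcal{C}\times\mathcal{C} : A\le_* B \text{ or } B\le_* A\bigr\}$$ is closed and nowhere dense in $(\mathcal{C}\times\mathcal{C},d\times d)$, and its complement $\mathcal{P}_*^{c}$ is open and co-meager. Consequently, the set $(\mathcal{P}_{\mathrm{icx}}\cup\mathcal{P}_{\mathrm{cx}}\cup\mathcal{P}_{\mathrm{sl}})^{c}$ is co-meager in $(\mathcal{C}\times\mathcal{C},d\times d)$, and a topologically generic pair of bivariate copulas is incomparable in $\le_{\mathrm{icx}}$, $\le_{\mathrm{cx}}$, $\le_{\mathrm{sl}}$, $\le_{\mathrm{lo}}$ and $\le_{\mathrm{sm}}$ simultaneously; that is, the set of pairs $(A,B)\in\mathcal{C}\times\mathcal{C}$ such that, for every $*\in\{\mathrm{icx},\mathrm{cx},\mathrm{sl},\mathrm{lo},\mathrm{sm}\}$, neither $A\le_* B$ nor $B\le_* A$ holds, is co-meager in $(\mathcal{C}\times\mathcal{C},d\times d)$.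
   Context: A (bivariate) copula is a function $C:[0,1]^2\to[0,1]$ such that $C(t,0)=C(0,t)=0$ and $C(t,1)=C(1,t)=t$ for all $t\in[0,1]$, and $C(u',v')-C(u,v')-C(u',v)+C(u,v)\ge 0$ whenever $u\le u'$, $v\le v'$ in $[0,1]$. Equivalently, $C$ is the restriction to $[0,1]^2$ of the distribution function of a Borel probability measure on $[0,1]^2$ with both marginals uniform on $[0,1]$; $\int_{[0,1]^2}\varphi\,{\rm d}C$ denotes the integral of $\varphi$ with respect to this measure, and $(X,Y)\sim C$ means that $(X,Y)$ has this law. $\mathcal{C}$ is the set of all copulas, with the uniform metric $d(A,B)=\sup_{(x,y)\in[0,1]^2}|A(x,y)-B(x,y)|$. The product $\mathcal{C}\times\mathcal{C}$ carries the metric $(d\times d)((A,B),(A',B'))=\max\{d(A,A'),d(B,B')\}$. For $A,B\in\mathcal{C}$: (i) $A\le_{\mathrm{icx}}B$ (increasing convex order) means $\int_{[0,1]^2}\varphi\,{\rm d}A\le\int_{[0,1]^2}\varphi\,{\rm d}B$ for every finite-valued $\varphi:[0,1]^2\to\mathbb{R}$ that is non-decreasing in each argument and (jointly) convex. (ii) $A\le_{\mathrm{cx}}B$ (convex order) means the same inequality for every convex $\varphi:[0,1]^2\to\mathbb{R}$ (no monotonicity required). (iii) $A\le_{\mathrm{sl}}B$ (stop-loss order on sums) means $\mathbb{E}[(S_A-t)^+]\le\mathbb{E}[(S_B-t)^+]$ for every $t\in\mathbb{R}$, where $S_A=X+Y$ with $(X,Y)\sim A$, $S_B=X'+Y'$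 with $(X',Y')\sim B$, and $z^+=\max(z,0)$. (iv) $A\le_{\mathrm{lo}}B$ (lower orthant order) means $B(x,y)\le A(x,y)$ for every $(x,y)\in[0,1]^2$. (v) $A\le_{\mathrm{sm}}B$ (supermodular order) means $\int_{[0,1]^2}\varphi\,{\rm d}A\le\int_{[0,1]^2}\varphi\,{\rm d}B$ for every supermodular $\varphi:[0,1]^2\to\mathbb{R}$ for which both integrals exist, where $\varphi$ is supermodular if $\varphi(x_1,y_1)+\varphi(x_2,y_2)\le\varphi(\min\{x_1,x_2\},\min\{y_1,y_2\})+\varphi(\max\{x_1,x_2\},\max\{y_1,y_2\})$ for all $x_1,x_2,y_1,y_2\in[0,1]$. A set is nowhere dense if its closure has empty interior, meager if it is a countable union of nowhere dense sets, and co-meager if its complement is meager. A property holds for a (topologically) generic element if the set of elements having it is co-meager. *)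

theory Defs
  imports "HOL-Probability.Probability"
begin

abbreviation unit_square :: "(real \<times> real) set" where
  "unit_square \<equiv> {0..1} \<times> {0..1}"

text \<open>A function on the unit square is represented by its extensional total version, so that
  copulas which agree on the square are equal.\<close>

definition copulas :: "(real \<times> real \<Rightarrow> real) set" where
  "copulas = {C \<in> unit_square \<rightarrow>\<^sub>E {0..1}.
     (\<forall>t\<in>{0..1}. C (t, 0) = 0 \<and> C (0, t) = 0 \<and> C (t, 1) = t \<and> C (1, t) = t) \<and>
     (\<forall>u\<in>{0..1}. \<forall>u'\<in>{0..1}. \<forall>v\<in>{0..1}. \<forall>v'\<in>{0..1}. u \<le> u' \<longrightarrow> v \<le> v' \<longrightarrow>
        C (u', v') - C (u, v') - C (u', v) + C (u, v) \<ge> 0)}"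

text \<open>The guard makes the locale assumptions of \<^locale>\<open>Metric_space\<close>, which are partly
  required outside the carrier, provable (the supremum of an unbounded set is unspecified).\<close>

definition copula_dist :: "(real \<times> real \<Rightarrow> real) \<Rightarrow> (real \<times> real \<Rightarrow> real) \<Rightarrow> real" where
  "copula_dist A B =
     (if A \<in> copulas \<and> B \<in> copulas then SUP p\<in>unit_square. \<bar>A p - B p\<bar> else 0)"

definition copula_pair_dist ::
  "(real \<times> real \<Rightarrow> real) \<times> (real \<times> real \<Rightarrow> real) \<Rightarrow>
   (real \<times> real \<Rightarrow> real) \<times> (real \<times> real \<Rightarrow> real) \<Rightarrow> real" where
  "copula_pair_dist = (\<lambda>(A, B) (A', B'). max (copula_dist A A') (copula_dist B B'))"

definition copula_pair_topology ::
  "((real \<times> real \<Rightarrow> real) \<times> (real \<times> real \<Rightarrow> real)) topology" where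
  "copula_pair_topology = Metric_space.mtopology (copulas \<times> copulas) copula_pair_dist"

lemma Metric_space_copulas: "Metric_space copulas copula_dist"
proof
  have bdd: "bdd_above ((\<lambda>p. \<bar>A p - B p\<bar>) ` unit_square)"
    if "A \<in> copulas" "B \<in> copulas" for A B
  proof (rule bdd_aboveI2)
    fix p :: "real \<times> real"
    assume "p \<in> unit_square"
    then have "A p \<in> {0..1}" "B p \<in> {0..1}"
      using that by (auto simp: copulas_def PiE_iff)
    then show "\<bar>A p - B p\<bar> \<le> 1" by auto
  qed
  have le: "\<bar>A p - B p\<bar> \<le> copula_dist A B"
    if "A \<in> copulas" "B \<in> copulas" "p \<in> unit_square" for A B p
    using cSUP_upper[OF that(3) bdd[OF that(1,2)]] that by (simp add: copula_dist_def)
  have ne: "unit_square \<noteq> {}" by auto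
  have origin: "(0, 0) \<in> unit_square" by simp
  show "0 \<le> copula_dist A B" for A B
    using le[OF _ _ origin, of A B] by (force simp: copula_dist_def)
  show "copula_dist A B = copula_dist B A" for A B
    by (simp add: copula_dist_def abs_minus_commute)
  show "copula_dist A B = 0 \<longleftrightarrow> A = B" if AB: "A \<in> copulas" "B \<in> copulas" for A B
  proof
    assume z: "copula_dist A B = 0"
    show "A = B"
    proof (rule extensionalityI)
      show "A \<in> extensional unit_square" "B \<in> extensional unit_square"
        using AB by (auto simp: copulas_def PiE_iff)
      show "A p = B p" if "p \<in> unit_square" for p
        using le[OF AB that] z by simp
    qed
  qed (use ne in \<open>simp add: copula_dist_def\<close>)
  show "copula_dist A D \<le> copula_dist A B + copula_dist B D"
    if "A \<in> copulas" "B \<in> copulas" "D \<in> copulas" for A B D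
  proof -
    have "(SUP p\<in>unit_square. \<bar>A p - D p\<bar>) \<le> copula_dist A B + copula_dist B D"
    proof (rule cSUP_least[OF ne])
      fix p :: "real \<times> real"
      assume "p \<in> unit_square"
      then show "\<bar>A p - D p\<bar> \<le> copula_dist A B + copula_dist B D"
        using le[of A B p] le[of B D p] that by linarith
    qed
    then show ?thesis using that by (simp add: copula_dist_def)
  qed
qed

lemma Metric_space_copula_pairs: "Metric_space (copulas \<times> copulas) copula_pair_dist"
proof -
  interpret Metric_space copulas copula_dist by (rule Metric_space_copulas)
  show ?thesis
  proof
    fix p q r :: "(real \<times> real \<Rightarrow> real) \<times> (real \<times> real \<Rightarrow> real)"
    show "0 \<le> copula_pair_dist p q"
      by (auto simp: copula_pair_dist_def split: prod.splits intro: max.coboundedI1)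
    show "copula_pair_dist p q = copula_pair_dist q p"
      by (auto simp: copula_pair_dist_def commute split: prod.splits)
    assume p: "p \<in> copulas \<times> copulas" and q: "q \<in> copulas \<times> copulas"
    obtain A B A' B' where pq: "p = (A, B)" "q = (A', B')" by (cases p, cases q)
    have mem: "A \<in> copulas" "B \<in> copulas" "A' \<in> copulas" "B' \<in> copulas"
      using p q pq by auto
    have "max (copula_dist A A') (copula_dist B B') = 0 \<longleftrightarrow>
        copula_dist A A' = 0 \<and> copula_dist B B' = 0"
      using nonneg[of A A'] nonneg[of B B'] by (smt (verit))
    then show "copula_pair_dist p q = 0 \<longleftrightarrow> p = q"
      using mem by (simp add: copula_pair_dist_def pq)
    assume r: "r \<in> copulas \<times> copulas"
    obtain D E where r': "r = (D, E)" by (cases r)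
    then have mem': "D \<in> copulas" "E \<in> copulas" using r by auto
    show "copula_pair_dist p r \<le> copula_pair_dist p q + copula_pair_dist q r"
      using triangle[OF mem(1,3) mem'(1)] triangle[OF mem(2,4) mem'(2)]
      unfolding copula_pair_dist_def pq r' prod.case by (smt (verit))
  qed
qed

text \<open>The law of a copula: the Borel probability measure on the unit square whose distribution
  function restricts to the copula. Uniformity of the marginals is the case where one
  coordinate equals 1.\<close>

definition copula_measure :: "(real \<times> real \<Rightarrow> real) \<Rightarrow> (real \<times> real) measure" where
  "copula_measure C = (THE M. prob_space M \<and> sets M = sets (restrict_space borel unit_square) \<and>
     (\<forall>x\<in>{0..1}. \<forall>y\<in>{0..1}. measure M ({0..x} \<times> {0..y}) = C (x, y)))"

text \<open>Finite convex functions on the closed square are bounded and upper semicontinuous, hence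
  integrable with respect to every copula measure, so the two orders below need no
  integrability side condition.\<close>

definition le_icx :: "(real \<times> real \<Rightarrow> real) \<Rightarrow> (real \<times> real \<Rightarrow> real) \<Rightarrow> bool" where
  "le_icx A B \<longleftrightarrow> (\<forall>\<phi>. convex_on unit_square \<phi> \<longrightarrow>
     (\<forall>y\<in>{0..1}. mono_on {0..1} (\<lambda>x. \<phi> (x, y))) \<longrightarrow>
     (\<forall>x\<in>{0..1}. mono_on {0..1} (\<lambda>y. \<phi> (x, y))) \<longrightarrow>
     (\<integral>p. \<phi> p \<partial>copula_measure A) \<le> (\<integral>p. \<phi> p \<partial>copula_measure B))"

definition le_cx :: "(real \<times> real \<Rightarrow> real) \<Rightarrow> (real \<times> real \<Rightarrow> real) \<Rightarrow> bool" where
  "le_cx A B \<longleftrightarrow> (\<forall>\<phi>. convex_on unit_square \<phi> \<longrightarrow>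
     (\<integral>p. \<phi> p \<partial>copula_measure A) \<le> (\<integral>p. \<phi> p \<partial>copula_measure B))"

text \<open>The pair \<open>(X, Y)\<close> with law \<open>C\<close> is realised by the coordinates on the probability space
  \<^term>\<open>copula_measure C\<close>.\<close>

definition le_sl :: "(real \<times> real \<Rightarrow> real) \<Rightarrow> (real \<times> real \<Rightarrow> real) \<Rightarrow> bool" where
  "le_sl A B \<longleftrightarrow> (\<forall>t::real.
     prob_space.expectation (copula_measure A) (\<lambda>(x, y). max (x + y - t) 0) \<le>
     prob_space.expectation (copula_measure B) (\<lambda>(x, y). max (x + y - t) 0))"

definition le_lo :: "(real \<times> real \<Rightarrow> real) \<Rightarrow> (real \<times> real \<Rightarrow> real) \<Rightarrow> bool" where
  "le_lo A B \<longleftrightarrow> (\<forall>p\<in>unit_square. B p \<le> A p)"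

definition supermodular :: "(real \<times> real \<Rightarrow> real) \<Rightarrow> bool" where
  "supermodular \<phi> \<longleftrightarrow>
     (\<forall>x1\<in>{0..1}. \<forall>x2\<in>{0..1}. \<forall>y1\<in>{0..1}. \<forall>y2\<in>{0..1}.
        \<phi> (x1, y1) + \<phi> (x2, y2) \<le> \<phi> (min x1 x2, min y1 y2) + \<phi> (max x1 x2, max y1 y2))"

definition le_sm :: "(real \<times> real \<Rightarrow> real) \<Rightarrow> (real \<times> real \<Rightarrow> real) \<Rightarrow> bool" where
  "le_sm A B \<longleftrightarrow> (\<forall>\<phi>. supermodular \<phi> \<longrightarrow>
     integrable (copula_measure A) \<phi> \<longrightarrow> integrable (copula_measure B) \<phi> \<longrightarrow>
     (\<integral>p. \<phi> p \<partial>copula_measure A) \<le> (\<integral>p. \<phi> p \<partial>copula_measure B))"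

definition comparability_set ::
  "((real \<times> real \<Rightarrow> real) \<Rightarrow> (real \<times> real \<Rightarrow> real) \<Rightarrow> bool) \<Rightarrow>
   ((real \<times> real \<Rightarrow> real) \<times> (real \<times> real \<Rightarrow> real)) set" where
  "comparability_set le = {(A, B) \<in> copulas \<times> copulas. le A B \<or> le B A}"

definition nowhere_dense_in :: "'a topology \<Rightarrow> 'a set \<Rightarrow> bool" where
  "nowhere_dense_in X S \<longleftrightarrow> S \<subseteq> topspace X \<and> X interior_of (X closure_of S) = {}"

definition meager_in :: "'a topology \<Rightarrow> 'a set \<Rightarrow> bool" where
  "meager_in X S \<longleftrightarrow> (\<exists>F. countable F \<and> (\<forall>N\<in>F. nowhere_dense_in X N) \<and> S = \<Union>F)"

definition comeager_in :: "'a topology \<Rightarrow> 'a set \<Rightarrow> bool" where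
  "comeager_in X S \<longleftrightarrow> S \<subseteq> topspace X \<and> meager_in X (topspace X - S)"

end

theory Submission
  imports Defs
begin

text \<open>Each of the five orders, up to exchanging the two copulas, implies the stop-loss order on sums,
  so every comparability set lies in that of the stop-loss order. The latter has empty interior: an
  ordinal sum replaces a copula near the corners \<open>(0, 0)\<close> and \<open>(1, 1)\<close> at small uniform distance, and
  a pair that is comonotone and countermonotone at the two corners, respectively the other way
  round, is strictly ordered in opposite directions by the stop-loss transforms at \<open>t = d\<close> and
  \<open>t = 2 - d\<close>. The increasing convex, convex and stop-loss orders are closed because they are determined by continuous test functions, for
  which the integral depends continuously on the copula; a discontinuous convex function is
  approximated by its contractions towards the centre of the square.\<close>

subsection \<open>Copulas\<close>

text \<open>\<open>copula_measure\<close> is a definite description, so no integral can be evaluated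
  before the law is known to exist and to be unique. Existence comes from pushing Lebesgue measure
  on \<open>[0, 1)\<close> forward along a pair of dyadic coordinates: a Z-order traversal of the
  square in which each cell is given time equal to its mass. The stop-loss transform at
  \<open>t\<close> is the integral over \<open>s\<close> of \<open>P (X > s, Y > t - s)\<close>. The
  uniform marginals cancel when two copulas are compared, so only their values on the line
  \<open>x + y = t\<close> count. For \<open>t = d\<close> this line meets the square inside
  \<open>[0, d]^2\<close>, for \<open>t = 2 - d\<close> inside \<open>[1 - d, 1]^2\<close>; hence
  the patches decide the comparison whatever the copulas do elsewhere. Two corners are used because
  a strict inequality at a single \<open>t\<close> refutes one direction only. Nowhere density of
  the lower orthant and supermodular comparability sets is inherited: the closed stop-loss set
  contains the closures of all five.\<close>

lemma copula_boundary:
  assumes "C \<in> copulas" "t \<in> {0..1}"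
  shows "C (t, 0) = 0" "C (0, t) = 0" "C (t, 1) = t" "C (1, t) = t"
  using assms by (auto simp: copulas_def)

lemma copula_volume_nonneg:
  assumes "C \<in> copulas" "0 \<le> u" "u \<le> u'" "u' \<le> 1" "0 \<le> v" "v \<le> v'" "v' \<le> 1"
  shows "C (u', v') - C (u, v') - C (u', v) + C (u, v) \<ge> 0"
  using assms by (auto simp: copulas_def)

text \<open>The two rectangles used rest on the axes, where the copula vanishes.\<close>

lemma copula_mono:
  assumes "C \<in> copulas" "0 \<le> u" "u \<le> u'" "u' \<le> 1" "0 \<le> v" "v \<le> v'" "v' \<le> 1"
  shows "C (u, v) \<le> C (u', v')"
  using copula_volume_nonneg[of C u u' 0 v] copula_volume_nonneg[of C 0 u' v v']
    copula_boundary[of C] assms by simp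

text \<open>The two rectangles used reach the sides \<open>y = 1\<close> and \<open>x = 1\<close>,
  where the copula is the remaining coordinate.\<close>

lemma copula_upper_lipschitz:
  assumes "C \<in> copulas" "0 \<le> u" "u \<le> u'" "u' \<le> 1" "0 \<le> v" "v \<le> v'" "v' \<le> 1"
  shows "C (u', v') \<le> C (u, v) + (u' - u) + (v' - v)"
  using copula_volume_nonneg[of C u u' v 1] copula_volume_nonneg[of C u' 1 v v']
    copula_boundary[of C] assms by simp

lemma copula_lipschitz:
  assumes C: "C \<in> copulas" and uv: "u \<in> {0..1}" "u' \<in> {0..1}" "v \<in> {0..1}" "v' \<in> {0..1}"
  shows "\<bar>C (u', v') - C (u, v)\<bar> \<le> \<bar>u' - u\<bar> + \<bar>v' - v\<bar>"
proof -
  have a: "\<bar>C (u', w) - C (u, w)\<bar> \<le> \<bar>u' - u\<bar>" if "w \<in> {0..1}" for w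
    using copula_mono[OF C, of u u' w w] copula_mono[OF C, of u' u w w]
      copula_upper_lipschitz[OF C, of u u' w w] copula_upper_lipschitz[OF C, of u' u w w] uv that
    by (cases u u' rule: le_cases) auto
  have b: "\<bar>C (w, v') - C (w, v)\<bar> \<le> \<bar>v' - v\<bar>" if "w \<in> {0..1}" for w
    using copula_mono[OF C, of w w v v'] copula_mono[OF C, of w w v' v]
      copula_upper_lipschitz[OF C, of w w v v'] copula_upper_lipschitz[OF C, of w w v' v] uv that
    by (cases v v' rule: le_cases) auto
  show ?thesis using a[of v'] b[of u] uv by auto
qed

subsection \<open>Existence and uniqueness of the law\<close>

text \<open>\<open>morton_x n k\<close> and \<open>morton_y n k\<close> are the coordinates of the dyadic cell of level \<open>n\<close> with
  index \<open>k < 4 ^ n\<close> in Z-order: the children of cell \<open>k\<close> have the indices \<open>4 k, \<dots>, 4 k + 3\<close>.\<close>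

primrec morton_x :: "nat \<Rightarrow> nat \<Rightarrow> nat" where
  "morton_x 0 k = 0"
| "morton_x (Suc n) k = 2 * morton_x n (k div 4) + k mod 4 div 2"

primrec morton_y :: "nat \<Rightarrow> nat \<Rightarrow> nat" where
  "morton_y 0 k = 0"
| "morton_y (Suc n) k = 2 * morton_y n (k div 4) + k mod 2"

lemma morton_less: "morton_x n k < 2 ^ n" "morton_y n k < 2 ^ n"
proof (induction n arbitrary: k)
  case (Suc n)
  { case 1
    have "k mod 4 div 2 < 2" by (simp add: less_mult_imp_div_less)
    then show ?case using Suc(1)[of "k div 4"] by simp
  next
    case 2
    have "k mod 2 < 2" by simp
    then show ?case using Suc(2)[of "k div 4"] by simp
  }
qed simp_all

text \<open>The lowest bits of the two coordinates determine the last base 4 digit of the index; the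
  remaining bits belong to \<open>k div 4\<close> and are covered by the induction
  hypothesis.\<close>

lemma morton_inj:
  assumes "k < 4 ^ n" "l < 4 ^ n" "morton_x n k = morton_x n l" "morton_y n k = morton_y n l"
  shows "k = l"
  using assms
proof (induction n arbitrary: k l)
  case (Suc n)
  have x: "2 * morton_x n (k div 4) + k mod 4 div 2 = 2 * morton_x n (l div 4) + l mod 4 div 2"
    using Suc.prems by simp
  have y: "2 * morton_y n (k div 4) + k mod 2 = 2 * morton_y n (l div 4) + l mod 2"
    using Suc.prems by simp
  have bit_eq: "a = b \<and> r = s" if "2 * a + r = 2 * b + s" "r < 2" "s < 2" for a b r s :: nat
    using that by arith
  have "k mod 4 div 2 < 2" "l mod 4 div 2 < 2"
    by (simp_all add: less_mult_imp_div_less)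
  with x have x': "morton_x n (k div 4) = morton_x n (l div 4)" "k mod 4 div 2 = l mod 4 div 2"
    using bit_eq by blast+
  from y have y': "morton_y n (k div 4) = morton_y n (l div 4)" "k mod 2 = l mod 2"
    using bit_eq[OF y] by simp_all
  have "k div 4 < 4 ^ n" "l div 4 < 4 ^ n"
    using Suc.prems(1,2) by (simp_all add: less_mult_imp_div_less)
  then have q: "k div 4 = l div 4"
    by (rule Suc.IH) fact+
  \<comment> \<open>Reassembles an index from its quotient and the two bits of its last base 4
    digit.\<close>
  have digits: "a = 4 * (a div 4) + (2 * (a mod 4 div 2) + a mod 2)" for a :: nat
    by presburger
  show ?case
    by (rule trans[OF digits[of k, unfolded q x'(2) y'(2)] sym[OF digits[of l]]])
qed simp

text \<open>Injectivity suffices, as both sides have \<open>4 ^ n = 2 ^ n * 2 ^ n\<close>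
  elements.\<close>

lemma morton_bij:
  "bij_betw (\<lambda>k. (morton_x n k, morton_y n k)) {..<4 ^ n} ({..<2 ^ n} \<times> {..<2 ^ n})"
  unfolding bij_betw_def
proof
  show inj: "inj_on (\<lambda>k. (morton_x n k, morton_y n k)) {..<4 ^ n}"
    by (intro inj_onI) (auto intro: morton_inj)
  have "card {..<(4::nat) ^ n} = card ({..<(2::nat) ^ n} \<times> {..<(2::nat) ^ n})"
    by (simp add: card_cartesian_product flip: power_mult_distrib)
  then show "(\<lambda>k. (morton_x n k, morton_y n k)) ` {..<4 ^ n} = {..<2 ^ n} \<times> {..<2 ^ n}"
    using morton_less card_image[OF inj] by (intro card_subset_eq) auto
qed

text \<open>The position of \<open>t\<close> in the partition of \<open>{0..<1}\<close> into consecutive intervals of length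
  \<open>q n 0, q n 1, \<dots>\<close>. As the partition of level \<open>n + 1\<close> refines that of level \<open>n\<close>, this realises a
  consistent family of cell masses on one probability space.\<close>

locale cell_masses =
  fixes q :: "nat \<Rightarrow> nat \<Rightarrow> real"
  assumes nonneg: "\<And>n k. k < 4 ^ n \<Longrightarrow> 0 \<le> q n k"
    and split: "\<And>n k. k < 4 ^ n \<Longrightarrow> q n k = (\<Sum>c<4. q (Suc n) (4 * k + c))"
    and total: "q 0 0 = 1"
begin

definition cum :: "nat \<Rightarrow> nat \<Rightarrow> real" where
  "cum n k = (\<Sum>l<k. q n l)"

definition pos :: "nat \<Rightarrow> real \<Rightarrow> nat" where
  "pos n t = (LEAST k. t < cum n (Suc k))"

lemma cum_mono: "k \<le> l \<Longrightarrow> l \<le> 4 ^ n \<Longrightarrow> cum n k \<le> cum n l"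
  unfolding cum_def by (rule sum_mono2) (auto intro: nonneg)

text \<open>Every partition point of level \<open>n\<close> is also one of level
  \<open>n + 1\<close>, because four consecutive children share the mass of their parent. This is
  the refinement on which \<open>pos_Suc_div\<close> rests.\<close>

lemma cum_Suc: "k \<le> 4 ^ n \<Longrightarrow> cum (Suc n) (4 * k) = cum n k"
proof (induction k)
  case (Suc k)
  have "cum (Suc n) (4 * Suc k) = cum (Suc n) (4 * k) + (\<Sum>c<4. q (Suc n) (4 * k + c))"
  proof -
    have "4 * Suc k = Suc (Suc (Suc (Suc (4 * k))))" by simp
    moreover have "(\<Sum>c<4. f (4 * k + c)) = f (4 * k) + f (Suc (4 * k)) + f (Suc (Suc (4 * k)))
        + f (Suc (Suc (Suc (4 * k))))" for f :: "nat \<Rightarrow> real"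
      by (simp add: eval_nat_numeral)
    ultimately show ?thesis unfolding cum_def by (simp only: sum.lessThan_Suc add.assoc)
  qed
  then show ?case using Suc split[of k n] by (simp add: cum_def)
qed (simp add: cum_def)

lemma cum_total: "cum n (4 ^ n) = 1"
proof (induction n)
  case (Suc n)
  then show ?case using cum_Suc[of "4 ^ n" n] by simp
qed (simp add: cum_def total)

lemma pos_eq_iff:
  assumes "t \<in> {0..<1}" "k < 4 ^ n"
  shows "pos n t = k \<longleftrightarrow> cum n k \<le> t \<and> t < cum n (Suc k)"
proof
  \<comment> \<open>The last interval ends at the total mass 1, so the \<open>LEAST\<close> in
    \<open>pos\<close> ranges over a nonempty set.\<close>
  have "t < cum n (Suc (4 ^ n - 1))" using assms cum_total[of n] by simp
  then have *: "t < cum n (Suc (pos n t))" unfolding pos_def by (rule LeastI)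
  assume k: "pos n t = k"
  have "cum n k \<le> t"
  proof (cases k)
    case 0
    then show ?thesis using assms by (simp add: cum_def)
  next
    case (Suc l)
    then have "l < pos n t" using k by simp
    then show ?thesis using not_less_Least[of l "\<lambda>k. t < cum n (Suc k)"] Suc
      by (simp add: pos_def)
  qed
  with * k show "cum n k \<le> t \<and> t < cum n (Suc k)" by simp
next
  assume k: "cum n k \<le> t \<and> t < cum n (Suc k)"
  show "pos n t = k" unfolding pos_def
  proof (rule Least_equality)
    fix l assume "t < cum n (Suc l)"
    then have "cum n k < cum n (Suc l)" using k by simp
    then show "k \<le> l" using cum_mono[of "Suc l" k n] assms by (meson not_less not_less_eq_eq less_imp_le)
  qed (use k in simp)
qed

lemma pos_less:
  assumes "t \<in> {0..<1}"
  shows "pos n t < 4 ^ n"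
proof -
  have "t < cum n (Suc (4 ^ n - 1))" using assms cum_total[of n] by simp
  then have "pos n t \<le> 4 ^ n - 1" unfolding pos_def by (rule Least_le)
  then show ?thesis by (simp add: le_less_trans)
qed

text \<open>The interval of a child lies in that of its parent, so the positions of a fixed
  \<open>t\<close> at successive levels form a descending chain of cells.\<close>

lemma pos_Suc_div:
  assumes t: "t \<in> {0..<1}"
  shows "pos (Suc n) t div 4 = pos n t"
proof -
  define k where "k = pos (Suc n) t"
  have k: "k < 4 ^ Suc n" using pos_less[OF t] unfolding k_def .
  then have k': "k div 4 < 4 ^ n" by (simp add: less_mult_imp_div_less)
  have b: "cum (Suc n) k \<le> t \<and> t < cum (Suc n) (Suc k)"
    using pos_eq_iff[OF t k] k_def by simp
  have "cum n (k div 4) \<le> cum (Suc n) k"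
    using cum_Suc[of "k div 4" n] cum_mono[of "4 * (k div 4)" k "Suc n"] k k' by simp
  moreover have "cum (Suc n) (Suc k) \<le> cum n (Suc (k div 4))"
  proof -
    have "Suc k \<le> 4 * Suc (k div 4)" by presburger
    moreover have "4 * Suc (k div 4) \<le> 4 ^ Suc n" using k' by (metis Suc_leI mult_le_mono2 power_Suc)
    ultimately show ?thesis
      using cum_Suc[of "Suc (k div 4)" n] cum_mono[of "Suc k" "4 * Suc (k div 4)" "Suc n"] k' by simp
  qed
  ultimately show ?thesis
    using pos_eq_iff[OF t k'] b by (simp add: k_def)
qed

abbreviation base :: "real measure" where
  "base \<equiv> restrict_space lborel {0..<1}"

lemma space_base: "space base = {0..<1}"
  by (simp add: space_restrict_space)

lemma prob_space_base: "prob_space base"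
  by (rule prob_spaceI) (simp add: space_restrict_space emeasure_restrict_space)

lemma pos_vimage:
  assumes "k < 4 ^ n"
  shows "{t \<in> space base. pos n t = k} = {cum n k..<cum n (Suc k)}"
proof -
  have "0 \<le> cum n k" using cum_mono[of 0 k n] assms by (simp add: cum_def)
  moreover have "cum n (Suc k) \<le> 1" using cum_mono[of "Suc k" "4 ^ n" n] cum_total assms by simp
  ultimately have "t \<in> {0..<1} \<and> pos n t = k \<longleftrightarrow> t \<in> {cum n k..<cum n (Suc k)}" for t
    using pos_eq_iff[OF _ assms, of t] by fastforce
  then show ?thesis unfolding space_base by blast
qed

lemma cum_interval_subset:
  assumes "k < 4 ^ n"
  shows "{cum n k..<cum n (Suc k)} \<subseteq> {0..<1}"
  using pos_vimage[OF assms] space_base by blast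

lemma measurable_pos[measurable]: "pos n \<in> measurable base (count_space UNIV)"
proof (subst measurable_count_space_eq2_countable, safe)
  fix k
  show "pos n -` {k} \<inter> space base \<in> sets base"
  proof (cases "k < 4 ^ n")
    case True
    have "pos n -` {k} \<inter> space base = {cum n k..<cum n (Suc k)}"
      unfolding pos_vimage[OF True, symmetric] by blast
    then show ?thesis using cum_interval_subset[OF True] by (simp add: sets_restrict_space_iff)
  next
    case False
    then have "pos n -` {k} \<inter> space base = {}"
      using pos_less[of _ n] space_base by blast
    then show ?thesis by (simp only: sets.empty_sets)
  qed
qed simp_all

lemma measure_pos:
  assumes k: "k < 4 ^ n"
  shows "measure base {t \<in> space base. pos n t = k} = q n k"
proof -
  have sub: "{cum n k..<cum n (Suc k)} \<subseteq> {0..<1}"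
    by (rule cum_interval_subset[OF k])
  have "cum n k \<le> cum n (Suc k)" using cum_mono k by simp
  then show ?thesis
    unfolding pos_vimage[OF k] using sub
    by (simp add: measure_restrict_space) (simp add: cum_def)
qed

lemma measure_pos_in:
  assumes S: "S \<subseteq> {..<4 ^ n}"
  shows "measure base {t \<in> space base. pos n t \<in> S} = (\<Sum>k\<in>S. q n k)"
proof -
  interpret prob_space base by (rule prob_space_base)
  have fin: "finite S" using S finite_subset by blast
  have "{t \<in> space base. pos n t \<in> S} = (\<Union>k\<in>S. {t \<in> space base. pos n t = k})" by auto
  also have "measure base \<dots> = (\<Sum>k\<in>S. measure base {t \<in> space base. pos n t = k})"
  proof (rule finite_measure_finite_Union[OF fin])
    show "(\<lambda>k. {t \<in> space base. pos n t = k}) ` S \<subseteq> sets base"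
      by (intro image_subsetI) measurable
  qed (auto simp: disjoint_family_on_def)
  also have "\<dots> = (\<Sum>k\<in>S. q n k)"
    by (rule sum.cong[OF refl measure_pos]) (use S in blast)
  finally show ?thesis .
qed

end

section \<open>Dyadic cell masses of a copula and the law built from them\<close>

definition cell_mass :: "(real \<times> real \<Rightarrow> real) \<Rightarrow> nat \<Rightarrow> nat \<Rightarrow> nat \<Rightarrow> real" where
  "cell_mass C n i j = C (Suc i / 2 ^ n, Suc j / 2 ^ n) - C (i / 2 ^ n, Suc j / 2 ^ n)
     - C (Suc i / 2 ^ n, j / 2 ^ n) + C (i / 2 ^ n, j / 2 ^ n)"

lemma cell_mass_nonneg:
  assumes "C \<in> copulas" "i < 2 ^ n" "j < 2 ^ n"
  shows "0 \<le> cell_mass C n i j"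
proof -
  have "real (Suc k) / 2 ^ n \<le> 1" if "k < 2 ^ n" for k
    using of_nat_mono[OF Suc_leI[OF that], where 'a = real] by simp
  then show ?thesis
    unfolding cell_mass_def using assms
    by (intro copula_volume_nonneg) (auto simp: divide_right_mono)
qed

lemma cell_mass_split:
  "cell_mass C n i j =
     cell_mass C (Suc n) (2 * i) (2 * j) + cell_mass C (Suc n) (2 * i) (2 * j + 1) +
     cell_mass C (Suc n) (2 * i + 1) (2 * j) + cell_mass C (Suc n) (2 * i + 1) (2 * j + 1)"
proof -
  have "real (Suc (2 * k + 1)) / 2 ^ Suc n = real (Suc k) / 2 ^ n"
    "real (2 * k) / 2 ^ Suc n = real k / 2 ^ n"
    "real (2 * k + 1) / 2 ^ Suc n = real (Suc (2 * k)) / 2 ^ Suc n" for k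
    by (simp_all add: field_simps)
  then show ?thesis unfolding cell_mass_def by simp
qed

text \<open>The sum telescopes in both directions; the terms on the lower and left sides vanish by
  the boundary conditions.\<close>

lemma sum_cell_mass:
  assumes C: "C \<in> copulas" and ab: "a \<le> 2 ^ n" "b \<le> 2 ^ n"
  shows "(\<Sum>i<a. \<Sum>j<b. cell_mass C n i j) = C (a / 2 ^ n, b / 2 ^ n)"
proof -
  have le1: "real k / 2 ^ n \<in> {0..1}" if "k \<le> 2 ^ n" for k
    using of_nat_mono[OF that, where 'a = real] by simp
  define g where "g i = C (i / 2 ^ n, b / 2 ^ n) - C (i / 2 ^ n, 0)" for i :: nat
  have row: "(\<Sum>j<b. cell_mass C n i j) = g (Suc i) - g i" for i
  proof -
    define f where "f j = C (Suc i / 2 ^ n, j / 2 ^ n) - C (i / 2 ^ n, j / 2 ^ n)" for j :: nat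
    have "(\<Sum>j<b. cell_mass C n i j) = (\<Sum>j<b. f (Suc j) - f j)"
      by (intro sum.cong) (auto simp: f_def cell_mass_def)
    also have "\<dots> = f b - f 0" by (rule sum_lessThan_telescope)
    finally show ?thesis by (simp add: f_def g_def)
  qed
  have "(\<Sum>i<a. \<Sum>j<b. cell_mass C n i j) = g a - g 0"
    by (simp add: row sum_lessThan_telescope)
  then show ?thesis
    using copula_boundary[OF C le1] ab copula_boundary[OF C, of 0] by (simp add: g_def)
qed

lemma cell_masses_copula:
  assumes C: "C \<in> copulas"
  shows "cell_masses (\<lambda>n k. cell_mass C n (morton_x n k) (morton_y n k))"
proof
  fix n k :: nat
  show "0 \<le> cell_mass C n (morton_x n k) (morton_y n k)"
    using morton_less by (intro cell_mass_nonneg[OF C])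
  \<comment> \<open>Child \<open>c\<close> adds the bit \<open>c div 2\<close> to the first
    coordinate and \<open>c mod 2\<close> to the second, which matches the four cells of
    \<open>cell_mass_split\<close>.\<close>
  have "(4 * k + c) div 4 = k" "(4 * k + c) mod 4 = c" "(4 * k + c) mod 2 = c mod 2" if "c < 4" for c
    using that by presburger+
  then have "(\<Sum>c<4. cell_mass C (Suc n) (morton_x (Suc n) (4 * k + c)) (morton_y (Suc n) (4 * k + c))) =
      (\<Sum>c<4. cell_mass C (Suc n) (2 * morton_x n k + c div 2) (2 * morton_y n k + c mod 2))"
    by (intro sum.cong refl) (simp only: morton_x.simps morton_y.simps lessThan_iff)
  also have "\<dots> = cell_mass C n (morton_x n k) (morton_y n k)"
  proof -
    have "{..<4} = {0, 1, 2, 3::nat}" by auto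
    then show ?thesis by (simp add: cell_mass_split[of C n])
  qed
  finally show "cell_mass C n (morton_x n k) (morton_y n k) =
      (\<Sum>c<4. cell_mass C (Suc n) (morton_x (Suc n) (4 * k + c)) (morton_y (Suc n) (4 * k + c)))"
    by (rule sym)
next
  show "cell_mass C 0 (morton_x 0 0) (morton_y 0 0) = 1"
    using copula_boundary[OF C, of 0] copula_boundary[OF C, of 1] by (simp add: cell_mass_def)
qed

lemma bij_betw_subset_collect:
  assumes "bij_betw f A B"
  shows "bij_betw f {x \<in> A. f x \<in> B'} (B \<inter> B')"
  using assms by (auto simp: bij_betw_def inj_on_def)

text \<open>Nested intervals of length \<open>1 / 2 ^ n\<close>: the left ends increase, the right
  ends decrease, and both tend to \<open>x\<close>.\<close>

lemma dyadic_refinement_limit: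
  fixes i :: "nat \<Rightarrow> nat"
  assumes i: "\<And>n. i (Suc n) = 2 * i n \<or> i (Suc n) = 2 * i n + 1"
  defines "x \<equiv> lim (\<lambda>n. i n / 2 ^ n)"
  shows "i n / 2 ^ n \<le> x" "x \<le> (i n + 1) / 2 ^ n"
proof -
  let ?l = "\<lambda>n. i n / 2 ^ n :: real" and ?u = "\<lambda>n. (i n + 1) / 2 ^ n :: real"
  have "?l n \<le> ?l (Suc n) \<and> ?u (Suc n) \<le> ?u n" for n
    using i[of n] by (auto simp: field_simps)
  then have inc: "incseq ?l" and dec: "decseq ?u"
    by (simp_all add: incseq_SucI decseq_SucI)
  have lu: "?l m \<le> ?u 0" for m
    using decseqD[OF dec, of 0 m] by (simp add: field_simps)
  have "convergent ?l"
    using incseq_convergent[OF inc, of "?u 0"] lu unfolding convergent_def by blast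
  then have lim: "?l \<longlonglongrightarrow> x" by (simp add: x_def convergent_LIMSEQ_iff)
  show "?l n \<le> x" by (rule incseq_le[OF inc lim])
  have "(\<lambda>n. ?l n + (1 / 2) ^ n) \<longlonglongrightarrow> x + 0"
    by (intro tendsto_add lim LIMSEQ_realpow_zero) auto
  then have "?u \<longlonglongrightarrow> x" by (simp add: add_divide_distrib power_divide add.commute)
  then show "x \<le> ?u n" by (rule decseq_ge[OF dec])
qed

lemma dyadic_floor:
  fixes z :: real
  assumes z: "z \<in> {0..1}"
  shows "nat \<lfloor>z * 2 ^ n\<rfloor> \<le> 2 ^ n" "real (nat \<lfloor>z * 2 ^ n\<rfloor>) \<le> z * 2 ^ n"
    "z * 2 ^ n \<le> real (nat \<lfloor>z * 2 ^ n\<rfloor>) + 1"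
proof -
  have nn: "0 \<le> z * 2 ^ n" using z by simp
  then show le: "real (nat \<lfloor>z * 2 ^ n\<rfloor>) \<le> z * 2 ^ n" by (rule of_nat_floor)
  show "z * 2 ^ n \<le> real (nat \<lfloor>z * 2 ^ n\<rfloor>) + 1" using nn by linarith
  have "z * 2 ^ n \<le> 1 * 2 ^ n" using z by (intro mult_right_mono) auto
  from order_trans[OF le this] have "real (nat \<lfloor>z * 2 ^ n\<rfloor>) \<le> real (2 ^ n)"
    by (simp only: mult_1 of_nat_power of_nat_numeral)
  then show "nat \<lfloor>z * 2 ^ n\<rfloor> \<le> 2 ^ n" using of_nat_le_iff by blast
qed

definition is_copula_law :: "(real \<times> real \<Rightarrow> real) \<Rightarrow> (real \<times> real) measure \<Rightarrow> bool" where
  "is_copula_law C M \<longleftrightarrow> prob_space M \<and> sets M = sets (restrict_space borel unit_square) \<and>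
     (\<forall>x\<in>{0..1}. \<forall>y\<in>{0..1}. measure M ({0..x} \<times> {0..y}) = C (x, y))"

text \<open>A uniform \<open>t\<close> is read as a descending chain of dyadic cells that shrinks to
  the point \<open>(X t, Y t)\<close>. Cell masses do not tell on which side of a cell border the
  limit falls, so the distribution function of \<open>(X, Y)\<close> is only sandwiched between grid
  values of \<open>C\<close>; the Lipschitz bound closes the gap as the mesh shrinks.\<close>

lemma copula_law_exists:
  assumes C: "C \<in> copulas"
  shows "\<exists>M. is_copula_law C M"
proof -
  interpret cell_masses "\<lambda>n k. cell_mass C n (morton_x n k) (morton_y n k)"
    by (rule cell_masses_copula[OF C])
  interpret prob_space base by (rule prob_space_base)
  define I where "I n t = morton_x n (pos n t)" for n t
  define J where "J n t = morton_y n (pos n t)" for n t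
  define X where "X t = lim (\<lambda>n. I n t / 2 ^ n)" for t
  define Y where "Y t = lim (\<lambda>n. J n t / 2 ^ n)" for t
  have [measurable]: "I n \<in> measurable base (count_space UNIV)" "J n \<in> measurable base (count_space UNIV)" for n
    unfolding I_def J_def by measurable
  have [measurable]: "X \<in> borel_measurable base" "Y \<in> borel_measurable base"
    unfolding X_def Y_def by measurable
  have X: "I n t / 2 ^ n \<le> X t" "X t \<le> (I n t + 1) / 2 ^ n" if t: "t \<in> space base" for n t
  proof -
    have t: "t \<in> {0..<1}" using t by (simp add: space_restrict_space)
    have "I (Suc n) t = 2 * I n t \<or> I (Suc n) t = 2 * I n t + 1" for n
    proof -
      have "pos (Suc n) t mod 4 div 2 = 0 \<or> pos (Suc n) t mod 4 div 2 = 1" by presburger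
      then show ?thesis by (auto simp: I_def pos_Suc_div[OF t])
    qed
    then show "I n t / 2 ^ n \<le> X t" "X t \<le> (I n t + 1) / 2 ^ n"
      unfolding X_def by (rule dyadic_refinement_limit[of "\<lambda>n. I n t"])+
  qed
  have Y: "J n t / 2 ^ n \<le> Y t" "Y t \<le> (J n t + 1) / 2 ^ n" if t: "t \<in> space base" for n t
  proof -
    have t: "t \<in> {0..<1}" using t by (simp add: space_restrict_space)
    have "J (Suc n) t = 2 * J n t \<or> J (Suc n) t = 2 * J n t + 1" for n
      by (auto simp: J_def pos_Suc_div[OF t])
    then show "J n t / 2 ^ n \<le> Y t" "Y t \<le> (J n t + 1) / 2 ^ n"
      unfolding Y_def by (rule dyadic_refinement_limit[of "\<lambda>n. J n t"])+
  qed
  have sq: "(X t, Y t) \<in> unit_square" if "t \<in> space base" for t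
    using X[OF that, of 0] Y[OF that, of 0] by (simp add: I_def J_def)
  have XY[measurable]: "(\<lambda>t. (X t, Y t)) \<in> measurable base (restrict_space borel unit_square)"
    using sq by (intro measurable_restrict_space2) (auto simp: borel_prod[symmetric])
  have grid: "measure base {t \<in> space base. I n t < a \<and> J n t < b} = C (a / 2 ^ n, b / 2 ^ n)"
    if ab: "a \<le> 2 ^ n" "b \<le> 2 ^ n" for n a b
  proof -
    define S where "S = {k \<in> {..<4 ^ n}. (morton_x n k, morton_y n k) \<in> {..<a} \<times> {..<b}}"
    have "bij_betw (\<lambda>k. (morton_x n k, morton_y n k)) S
        ({..<2 ^ n} \<times> {..<2 ^ n} \<inter> {..<a} \<times> {..<b})"
      unfolding S_def by (rule bij_betw_subset_collect[OF morton_bij])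
    also have "{..<2 ^ n} \<times> {..<2 ^ n} \<inter> {..<a} \<times> {..<b} = {..<a} \<times> {..<b}" using ab by auto
    finally have bij: "bij_betw (\<lambda>k. (morton_x n k, morton_y n k)) S ({..<a} \<times> {..<b})" .
    have "{t \<in> space base. I n t < a \<and> J n t < b} = {t \<in> space base. pos n t \<in> S}"
      using pos_less by (auto simp: S_def I_def J_def space_restrict_space)
    then have "measure base {t \<in> space base. I n t < a \<and> J n t < b} =
        (\<Sum>k\<in>S. cell_mass C n (morton_x n k) (morton_y n k))"
      by (simp only: measure_pos_in[of S n, unfolded S_def, OF Collect_restrict] S_def)
    also have "\<dots> = (\<Sum>(i, j)\<in>{..<a} \<times> {..<b}. cell_mass C n i j)"
      using sum.reindex_bij_betw[OF bij, of "\<lambda>(i, j). cell_mass C n i j"] by simp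
    also have "\<dots> = C (a / 2 ^ n, b / 2 ^ n)"
      by (simp flip: sum.cartesian_product add: sum_cell_mass[OF C ab])
    finally show ?thesis .
  qed
  have cdf: "measure base {t \<in> space base. X t \<le> x \<and> Y t \<le> y} = C (x, y)"
    if xy: "x \<in> {0..1}" "y \<in> {0..1}" for x y
  proof -
    let ?m = "measure base {t \<in> space base. X t \<le> x \<and> Y t \<le> y}"
    \<comment> \<open>One mesh width per coordinate: \<open>?m\<close> lies between values of
      \<open>C\<close> at grid points that differ from \<open>(x, y)\<close> by at most
      \<open>1 / 2 ^ n\<close> in each coordinate.\<close>
    have approx: "\<bar>?m - C (x, y)\<bar> \<le> 2 * (1 / 2 ^ n)" for n
    proof -
      define a b where "a = nat \<lfloor>x * 2 ^ n\<rfloor>" and "b = nat \<lfloor>y * 2 ^ n\<rfloor>"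
      have a: "a \<le> 2 ^ n" "a \<le> x * 2 ^ n" "x * 2 ^ n \<le> real a + 1"
        and b: "b \<le> 2 ^ n" "b \<le> y * 2 ^ n" "y * 2 ^ n \<le> real b + 1"
        unfolding a_def b_def using xy by (simp_all only: dyadic_floor)
      \<comment> \<open>The cap matters for \<open>x = 1\<close> or \<open>y = 1\<close>, where the
        index is already \<open>2 ^ n\<close> and \<open>grid\<close> admits no larger one.\<close>
      define a' b' where "a' = min (a + 1) (2 ^ n)" and "b' = min (b + 1) (2 ^ n)"
      have pow: "(0::real) < 2 ^ n" by simp
      have "x \<le> (real a + 1) / 2 ^ n" "y \<le> (real b + 1) / 2 ^ n"
        using a b pow by (simp_all add: pos_le_divide_eq)
      then have "x - 1 / 2 ^ n \<le> a / 2 ^ n" "y - 1 / 2 ^ n \<le> b / 2 ^ n"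
        by (simp_all add: add_divide_distrib)
      moreover have "a / 2 ^ n \<le> x" "b / 2 ^ n \<le> y"
        using a b pow by (simp_all add: pos_divide_le_eq)
      ultimately have dn: "a / 2 ^ n \<in> {0..1}" "x - 1 / 2 ^ n \<le> a / 2 ^ n" "a / 2 ^ n \<le> x"
         "b / 2 ^ n \<in> {0..1}" "y - 1 / 2 ^ n \<le> b / 2 ^ n" "b / 2 ^ n \<le> y"
        using xy a(1) b(1) by auto
      have up: "a' / 2 ^ n \<in> {0..1}" "x \<le> a' / 2 ^ n" "a' / 2 ^ n \<le> x + 1 / 2 ^ n"
         "b' / 2 ^ n \<in> {0..1}" "y \<le> b' / 2 ^ n" "b' / 2 ^ n \<le> y + 1 / 2 ^ n"
      proof -
        show "a' / 2 ^ n \<in> {0..1}" "b' / 2 ^ n \<in> {0..1}"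
          using of_nat_mono[of a' "2 ^ n", where 'a = real] of_nat_mono[of b' "2 ^ n", where 'a = real]
          by (simp_all add: a'_def b'_def)
        show "x \<le> a' / 2 ^ n" "y \<le> b' / 2 ^ n"
          using a b xy pow by (auto simp: a'_def b'_def min_def field_simps)
        have "a' / 2 ^ n \<le> (real a + 1) / 2 ^ n" "b' / 2 ^ n \<le> (real b + 1) / 2 ^ n"
          by (intro divide_right_mono; simp add: a'_def b'_def)+
        then show "a' / 2 ^ n \<le> x + 1 / 2 ^ n" "b' / 2 ^ n \<le> y + 1 / 2 ^ n"
          using dn by (auto simp: add_divide_distrib)
      qed
      \<comment> \<open>From \<open>X t <= x\<close> only \<open>I n t <= a\<close> follows, so the
        upper bound needs the next grid index.\<close>
      have "?m \<le> measure base {t \<in> space base. I n t < a' \<and> J n t < b'}"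
      proof (intro finite_measure_mono subsetI)
        fix t assume t: "t \<in> {t \<in> space base. X t \<le> x \<and> Y t \<le> y}"
        have "I n t / 2 ^ n \<le> x" "J n t / 2 ^ n \<le> y" using t X(1)[of t n] Y(1)[of t n] by auto
        then have "real (I n t) \<le> x * 2 ^ n" "real (J n t) \<le> y * 2 ^ n"
          using pow by (simp_all add: field_simps)
        then have "I n t \<le> a" "J n t \<le> b"
          unfolding a_def b_def by (simp_all only: le_nat_floor)
        then show "t \<in> {t \<in> space base. I n t < a' \<and> J n t < b'}"
          using t morton_less by (auto simp: a'_def b'_def I_def J_def)
      qed measurable
      also have "\<dots> = C (a' / 2 ^ n, b' / 2 ^ n)" by (rule grid) (auto simp: a'_def b'_def)
      finally have U: "?m \<le> C (a' / 2 ^ n, b' / 2 ^ n)" .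
      \<comment> \<open>Here the whole cell of \<open>t\<close> lies to the left of
        \<open>a / 2 ^ n <= x\<close>, hence so does its limit point; likewise for the second
        coordinate.\<close>
      have "measure base {t \<in> space base. I n t < a \<and> J n t < b} \<le> ?m"
      proof (intro finite_measure_mono subsetI)
        fix t assume t: "t \<in> {t \<in> space base. I n t < a \<and> J n t < b}"
        then have "real (I n t) + 1 \<le> real a" "real (J n t) + 1 \<le> real b" by auto
        then have "(I n t + 1) / 2 ^ n \<le> x" "(J n t + 1) / 2 ^ n \<le> y"
          using a b pow by (auto simp: field_simps)
        then show "t \<in> {t \<in> space base. X t \<le> x \<and> Y t \<le> y}"
          using t X(2)[of t n] Y(2)[of t n] by auto
      qed measurable
      then have L: "C (a / 2 ^ n, b / 2 ^ n) \<le> ?m" by (simp only: grid[OF a(1) b(1)])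
      show ?thesis
        using U L copula_lipschitz[OF C, of x "a' / 2 ^ n" y "b' / 2 ^ n"]
          copula_lipschitz[OF C, of x "a / 2 ^ n" y "b / 2 ^ n"] xy up dn
        by linarith
    qed
    have "(\<lambda>n. 2 * (1 / 2 ^ n) :: real) \<longlonglongrightarrow> 2 * 0"
      using LIMSEQ_realpow_zero[of "1 / 2"]
      by (intro tendsto_mult tendsto_const) (simp add: power_divide)
    then have "\<bar>?m - C (x, y)\<bar> \<le> 0"
      using approx by (intro LIMSEQ_le_const[where X = "\<lambda>n. 2 * (1 / 2 ^ n)"]) auto
    then show ?thesis by simp
  qed
  define M where "M = distr base (restrict_space borel unit_square) (\<lambda>t. (X t, Y t))"
  have "measure M ({0..x} \<times> {0..y}) = C (x, y)" if xy: "x \<in> {0..1}" "y \<in> {0..1}" for x y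
  proof -
    have "{0..x} \<times> {0..y} \<in> sets (restrict_space borel unit_square)"
      using xy by (auto simp: sets_restrict_space_iff borel_prod[symmetric])
    then have "measure M ({0..x} \<times> {0..y}) = measure base {t \<in> space base. X t \<le> x \<and> Y t \<le> y}"
      unfolding M_def using sq
      by (subst measure_distr) (auto intro!: arg_cong[where f = "measure base"])
    then show ?thesis using cdf[OF xy] by simp
  qed
  moreover have "prob_space M" unfolding M_def by (rule prob_space_distr) measurable
  ultimately have "is_copula_law C M" by (simp add: is_copula_law_def M_def)
  then show ?thesis ..
qed

section \<open>Uniqueness of the law and its distribution function\<close>

definition clamp01 :: "real \<Rightarrow> real" where
  "clamp01 x = max 0 (min 1 x)"

lemma clamp01_simps[simp]: "0 \<le> clamp01 x" "clamp01 x \<le> 1"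
  by (auto simp: clamp01_def)

text \<open>Clamping extends the formula to all real arguments. This is used for the generating sets
  of the plane and later for \<open>(s, t - s)\<close> with \<open>s\<close> ranging over the whole
  line.\<close>

lemma is_copula_law_cdf:
  assumes C: "C \<in> copulas" and M: "is_copula_law C M"
  shows "measure M {p \<in> unit_square. fst p \<le> x \<and> snd p \<le> y} = C (clamp01 x, clamp01 y)"
proof (cases "x < 0 \<or> y < 0")
  case True
  then have e: "{p \<in> unit_square. fst p \<le> x \<and> snd p \<le> y} = {}" by auto
  have "clamp01 x = 0 \<or> clamp01 y = 0" using True by (auto simp: clamp01_def)
  then show ?thesis using copula_boundary[OF C] unfolding e by auto
next
  case False
  then have "{p \<in> unit_square. fst p \<le> x \<and> snd p \<le> y} = {0..clamp01 x} \<times> {0..clamp01 y}"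
    by (auto simp: clamp01_def)
  then show ?thesis using M by (simp add: is_copula_law_def)
qed

text \<open>Both laws are pushed to the Borel sets of the plane, where the lower left orthants form
  an intersection-stable generator on which the masses are known; equality is then pulled back to
  the square.\<close>

lemma is_copula_law_unique:
  assumes C: "C \<in> copulas" and M: "is_copula_law C M" and N: "is_copula_law C N"
  shows "M = N"
proof -
  have sp: "space K = unit_square" "sets K = sets (restrict_space borel unit_square)" "prob_space K"
    if "is_copula_law C K" for K
    using that sets_eq_imp_space_eq[of K "restrict_space borel unit_square"]
    by (auto simp: is_copula_law_def space_restrict_space)
  have sq: "unit_square \<in> sets borel" by (simp add: borel_prod[symmetric])
  have id: "(\<lambda>p. p) \<in> measurable K borel" if "is_copula_law C K" for K
    using sp(2)[OF that] measurable_cong_sets[OF sp(2)[OF that] refl]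
    by (metis measurable_id measurable_restrict_space1 id_def measurable_ident)
  have box: "emeasure (distr K borel (\<lambda>p. p)) {..z} = C (clamp01 (fst z), clamp01 (snd z))"
    if K: "is_copula_law C K" for K and z :: "real \<times> real"
  proof -
    interpret prob_space K by (rule sp(3)[OF K])
    have "(\<lambda>p. p) -` {..z} \<inter> space K = {p \<in> unit_square. fst p \<le> fst z \<and> snd p \<le> snd z}"
      unfolding sp(1)[OF K] by (auto simp: less_eq_prod_def)
    then show ?thesis
      using is_copula_law_cdf[OF C K] by (simp add: emeasure_distr[OF id[OF K]] emeasure_eq_measure)
  qed
  have "distr M borel (\<lambda>p. p) = distr N borel (\<lambda>p. p)"
  proof (rule measure_eqI_generator_eq)
    have "{..a} \<inter> {..b} = {..(min (fst a) (fst b), min (snd a) (snd b))}" for a b :: "real \<times> real"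
      by (auto simp: less_eq_prod_def)
    then show "Int_stable (range (\<lambda>z::real \<times> real. {..z}))"
      by (auto simp: Int_stable_def)
    show "range (\<lambda>z::real \<times> real. {..z}) \<subseteq> Pow UNIV" by simp
    show "emeasure (distr M borel (\<lambda>p. p)) X = emeasure (distr N borel (\<lambda>p. p)) X"
      if "X \<in> range (\<lambda>z::real \<times> real. {..z})" for X
      using that box[OF M] box[OF N] by auto
    show "sets (distr M borel (\<lambda>p. p)) = sigma_sets UNIV (range (\<lambda>z::real \<times> real. {..z}))"
      "sets (distr N borel (\<lambda>p. p)) = sigma_sets UNIV (range (\<lambda>z::real \<times> real. {..z}))"
      by (simp_all add: borel_eq_atMost)
    show "range (\<lambda>n::nat. {..(real n, real n)}) \<subseteq> range (\<lambda>z::real \<times> real. {..z})" by auto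
    show "(\<Union>n::nat. {..(real n, real n)}) = UNIV"
    proof safe
      fix a b :: real
      obtain n :: nat where "max a b \<le> n" using real_arch_simple by blast
      then show "(a, b) \<in> (\<Union>n::nat. {..(real n, real n)})" by auto
    qed simp
    show "emeasure (distr M borel (\<lambda>p. p)) {..(real i, real i)} \<noteq> \<infinity>" for i
      by (simp add: box[OF M])
  qed
  then have eq: "emeasure (distr M borel (\<lambda>p. p)) X = emeasure (distr N borel (\<lambda>p. p)) X" for X
    by simp
  show "M = N"
  proof (rule measure_eqI)
    show "sets M = sets N" by (simp add: sp(2)[OF M] sp(2)[OF N])
    fix X assume "X \<in> sets M"
    then have X: "X \<in> sets borel" "X \<subseteq> unit_square"
      using sq by (auto simp: sp(2)[OF M] sets_restrict_space_iff)
    have "(\<lambda>p. p) -` X \<inter> space K = X" if "is_copula_law C K" for K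
      using X(2) sp(1)[OF that] by auto
    then show "emeasure M X = emeasure N X"
      using eq[of X] X(1) M N by (simp add: emeasure_distr[OF id])
  qed
qed

lemma is_copula_law_copula_measure:
  assumes "C \<in> copulas"
  shows "is_copula_law C (copula_measure C)"
proof -
  have eq: "copula_measure C = (THE M. is_copula_law C M)"
    by (simp add: copula_measure_def is_copula_law_def)
  show ?thesis unfolding eq
    using copula_law_exists[OF assms] is_copula_law_unique[OF assms] by (blast intro: theI)
qed

lemma
  assumes C: "C \<in> copulas"
  shows prob_space_copula_measure: "prob_space (copula_measure C)"
    and sets_copula_measure: "sets (copula_measure C) = sets (restrict_space borel unit_square)"
    and space_copula_measure: "space (copula_measure C) = unit_square"
    and copula_measure_cdf:
      "measure (copula_measure C) {p \<in> unit_square. fst p \<le> x \<and> snd p \<le> y} = C (clamp01 x, clamp01 y)"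
proof -
  note M = is_copula_law_copula_measure[OF C]
  show "prob_space (copula_measure C)"
    and *: "sets (copula_measure C) = sets (restrict_space borel unit_square)"
    using M by (simp_all add: is_copula_law_def)
  show "space (copula_measure C) = unit_square"
    using sets_eq_imp_space_eq[OF *] by (simp add: space_restrict_space)
  show "measure (copula_measure C) {p \<in> unit_square. fst p \<le> x \<and> snd p \<le> y} = C (clamp01 x, clamp01 y)"
    by (rule is_copula_law_cdf[OF C M])
qed

definition survival :: "(real \<times> real \<Rightarrow> real) \<Rightarrow> real \<Rightarrow> real \<Rightarrow> real" where
  "survival C x y = 1 - clamp01 x - clamp01 y + C (clamp01 x, clamp01 y)"

lemma borel_measurable_copula_measure:
  assumes C: "C \<in> copulas"
  shows "f \<in> borel_measurable borel \<Longrightarrow> f \<in> borel_measurable (copula_measure C)"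
    and "continuous_on unit_square f \<Longrightarrow> f \<in> borel_measurable (copula_measure C)"
  unfolding measurable_cong_sets[OF sets_copula_measure[OF C] refl]
  by (rule measurable_restrict_space1, assumption)
     (rule borel_measurable_continuous_on_restrict)

lemma borel_measurable_copula_coordinates:
  assumes C: "C \<in> copulas"
  shows "fst \<in> borel_measurable (copula_measure C)" "snd \<in> borel_measurable (copula_measure C)"
  by (rule borel_measurable_copula_measure(2)[OF C] continuous_on_fst[OF continuous_on_id]
      continuous_on_snd[OF continuous_on_id])+

text \<open>Inclusion-exclusion for the complement of a union, with the uniform marginals giving the
  two single terms.\<close>

lemma copula_measure_survival:
  assumes C: "C \<in> copulas"
  shows "measure (copula_measure C) {p \<in> unit_square. x < fst p \<and> y < snd p} = survival C x y"
proof -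
  interpret prob_space "copula_measure C" by (rule prob_space_copula_measure[OF C])
  note [simp] = space_copula_measure[OF C]
  let ?X = "{p \<in> unit_square. fst p \<le> x}" and ?Y = "{p \<in> unit_square. snd p \<le> y}"
  note [measurable] = borel_measurable_copula_coordinates[OF C]
  have meas: "?X \<in> events" "?Y \<in> events"
    using measurable_sets[of fst "copula_measure C" borel "{..x}"]
      measurable_sets[of snd "copula_measure C" borel "{..y}"]
    by (simp_all add: vimage_def Int_def conj_commute)
  have "?X = {p \<in> unit_square. fst p \<le> x \<and> snd p \<le> 1}" "?Y = {p \<in> unit_square. fst p \<le> 1 \<and> snd p \<le> y}"
    by auto
  moreover have "clamp01 1 = 1" by (simp add: clamp01_def)
  ultimately have m: "prob ?X = clamp01 x" "prob ?Y = clamp01 y"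
    using copula_measure_cdf[OF C, of x 1] copula_measure_cdf[OF C, of 1 y]
      copula_boundary[OF C, of "clamp01 x"] copula_boundary[OF C, of "clamp01 y"]
    by (simp_all only: clamp01_simps atLeastAtMost_iff simp_thms)
  have "?X \<inter> ?Y = {p \<in> unit_square. fst p \<le> x \<and> snd p \<le> y}" by auto
  then have mi: "prob (?X \<inter> ?Y) = C (clamp01 x, clamp01 y)"
    using copula_measure_cdf[OF C, of x y] by simp
  have un: "prob (?X \<union> ?Y) = prob ?X + prob ?Y - prob (?X \<inter> ?Y)"
    by (rule measure_Un3) (use meas in \<open>simp_all only: fmeasurable_eq_sets\<close>)
  have "{p \<in> unit_square. x < fst p \<and> y < snd p} = space (copula_measure C) - (?X \<union> ?Y)" by auto
  then have "prob {p \<in> unit_square. x < fst p \<and> y < snd p} = prob (space (copula_measure C) - (?X \<union> ?Y))"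
    by (rule arg_cong)
  also have "\<dots> = 1 - prob (?X \<union> ?Y)"
    by (rule prob_compl[OF sets.Un[OF meas]])
  finally show ?thesis unfolding un m mi survival_def by simp
qed

subsection \<open>The stop-loss transform\<close>

definition stop_loss :: "(real \<times> real \<Rightarrow> real) \<Rightarrow> real \<Rightarrow> real" where
  "stop_loss C t = (\<integral>p. max (fst p + snd p - t) 0 \<partial>copula_measure C)"

lemma le_sl_iff: "le_sl A B \<longleftrightarrow> (\<forall>t. stop_loss A t \<le> stop_loss B t)"
  by (simp add: le_sl_def stop_loss_def case_prod_unfold)

lemma survival_nonneg:
  assumes "C \<in> copulas"
  shows "0 \<le> survival C x y"
  unfolding copula_measure_survival[OF assms, symmetric] by simp

text \<open>The number \<open>(x + y - t)^+\<close> is the length of the set of all \<open>s\<close>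
  with \<open>t - y < s < x\<close>; exchanging the two integrals turns the inner one into a
  survival probability. Measurability in \<open>s\<close> is a by-product of the same
  exchange.\<close>

lemma stop_loss_nn_integral:
  assumes C: "C \<in> copulas"
  shows "ennreal (stop_loss C t) = (\<integral>\<^sup>+ s. ennreal (survival C s (t - s)) \<partial>lborel)"
    and "(\<lambda>s. survival C s (t - s)) \<in> borel_measurable borel"
proof -
  let ?M = "copula_measure C"
  interpret prob_space ?M by (rule prob_space_copula_measure[OF C])
  interpret pair_sigma_finite ?M lborel ..
  note space = space_copula_measure[OF C]
  note [measurable] = borel_measurable_copula_coordinates[OF C]
  define f :: "(real \<times> real) \<times> real \<Rightarrow> ennreal" where
    "f = (\<lambda>(p, s). if s < fst p \<and> t - s < snd p then 1 else 0)"
  have f[measurable]: "f \<in> borel_measurable (?M \<Otimes>\<^sub>M lborel)"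
    unfolding f_def by measurable
  have inner_s: "(\<integral>\<^sup>+ s. f (p, s) \<partial>lborel) = ennreal (max (fst p + snd p - t) 0)" for p
  proof -
    have "(\<integral>\<^sup>+ s. f (p, s) \<partial>lborel) = (\<integral>\<^sup>+ s. indicator {t - snd p<..<fst p} s \<partial>lborel)"
      by (intro nn_integral_cong) (auto simp: f_def indicator_def)
    also have "\<dots> = emeasure lborel {t - snd p<..<fst p}" by simp
    also have "\<dots> = ennreal (max (fst p + snd p - t) 0)"
    proof (cases "t - snd p \<le> fst p")
      case True
      then show ?thesis by (simp add: max_def algebra_simps)
    next
      case False
      then have "{t - snd p<..<fst p} = {}" "max (fst p + snd p - t) 0 = 0" by auto
      then show ?thesis by simp
    qed
    finally show ?thesis .
  qed
  have inner_p: "(\<integral>\<^sup>+ p. f (p, s) \<partial>?M) = ennreal (survival C s (t - s))" for s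
  proof -
    let ?S = "{p \<in> unit_square. s < fst p \<and> t - s < snd p}"
    have S: "?S \<in> events"
      unfolding space[symmetric] by measurable
    have "(\<integral>\<^sup>+ p. f (p, s) \<partial>?M) = (\<integral>\<^sup>+ p. indicator ?S p \<partial>?M)"
      by (intro nn_integral_cong) (auto simp: f_def indicator_def space)
    also have "\<dots> = emeasure ?M ?S" using S by simp
    finally show ?thesis
      by (simp only: emeasure_eq_measure copula_measure_survival[OF C])
  qed
  have g[measurable]: "(\<lambda>p. max (fst p + snd p - t) 0) \<in> borel_measurable ?M" by measurable
  have "integrable ?M (\<lambda>p. max (fst p + snd p - t) 0)"
    by (rule integrable_const_bound[where B = "2 + \<bar>t\<bar>", OF _ g]) (auto simp: space intro!: AE_I2)
  then have "ennreal (stop_loss C t) = (\<integral>\<^sup>+ p. ennreal (max (fst p + snd p - t) 0) \<partial>?M)"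
    unfolding stop_loss_def by (intro nn_integral_eq_integral[symmetric]) auto
  also have "\<dots> = (\<integral>\<^sup>+ s. (\<integral>\<^sup>+ p. f (p, s) \<partial>?M) \<partial>lborel)"
    by (simp only: inner_s[symmetric] Fubini[OF f])
  finally show "ennreal (stop_loss C t) = (\<integral>\<^sup>+ s. ennreal (survival C s (t - s)) \<partial>lborel)"
    by (simp only: inner_p)
  have "(\<lambda>s. \<integral>\<^sup>+ p. f (p, s) \<partial>?M) \<in> borel_measurable lborel" by measurable
  then have "(\<lambda>s. ennreal (survival C s (t - s))) \<in> borel_measurable lborel"
    by (simp only: inner_p)
  then have "(\<lambda>s. enn2real (ennreal (survival C s (t - s)))) \<in> borel_measurable borel" by measurable
  then show "(\<lambda>s. survival C s (t - s)) \<in> borel_measurable borel"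
    by (simp only: enn2real_ennreal[OF survival_nonneg[OF C]])
qed

lemma stop_loss_nonneg: "0 \<le> stop_loss C t"
  unfolding stop_loss_def by (intro integral_nonneg_AE) auto

text \<open>In the survival function the marginal terms are the same for both copulas, so the
  integrands are ordered as the copulas are along the line.\<close>

lemma stop_loss_mono:
  assumes A: "A \<in> copulas" and B: "B \<in> copulas"
    and le: "\<And>s. A (clamp01 s, clamp01 (t - s)) \<le> B (clamp01 s, clamp01 (t - s))"
  shows "stop_loss A t \<le> stop_loss B t"
proof -
  have "ennreal (stop_loss A t) \<le> ennreal (stop_loss B t)"
    unfolding stop_loss_nn_integral(1)[OF A] stop_loss_nn_integral(1)[OF B]
    by (intro nn_integral_mono ennreal_leI) (simp add: survival_def le)
  then show ?thesis by (simp add: stop_loss_nonneg)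
qed

text \<open>The integrands differ strictly on \<open>(a, b)\<close>, a set of positive Lebesgue
  measure, and the smaller integral is finite.\<close>

lemma stop_loss_less:
  assumes A: "A \<in> copulas" and B: "B \<in> copulas"
    and le: "\<And>s. A (clamp01 s, clamp01 (t - s)) \<le> B (clamp01 s, clamp01 (t - s))"
    and less: "\<And>s. a < s \<Longrightarrow> s < b \<Longrightarrow> A (clamp01 s, clamp01 (t - s)) < B (clamp01 s, clamp01 (t - s))"
    and ab: "a < b"
  shows "stop_loss A t < stop_loss B t"
proof -
  note [measurable] = stop_loss_nn_integral(2)[OF A] stop_loss_nn_integral(2)[OF B]
  have "(\<integral>\<^sup>+ s. ennreal (survival A s (t - s)) \<partial>lborel) < (\<integral>\<^sup>+ s. ennreal (survival B s (t - s)) \<partial>lborel)"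
  proof (rule nn_integral_less)
    show "(\<integral>\<^sup>+ s. ennreal (survival A s (t - s)) \<partial>lborel) \<noteq> \<infinity>"
      unfolding stop_loss_nn_integral(1)[OF A, symmetric] by simp
    show "AE s in lborel. ennreal (survival A s (t - s)) \<le> ennreal (survival B s (t - s))"
      by (intro AE_I2 ennreal_leI) (simp add: survival_def le)
    show "\<not> (AE s in lborel. ennreal (survival B s (t - s)) \<le> ennreal (survival A s (t - s)))"
    proof
      assume "AE s in lborel. ennreal (survival B s (t - s)) \<le> ennreal (survival A s (t - s))"
      then have "AE s in lborel. s \<notin> {a<..<b}"
      proof eventually_elim
        case (elim s)
        then have "survival B s (t - s) \<le> survival A s (t - s)"
          by (simp add: survival_nonneg[OF A])
        then show ?case using less[of s] by (auto simp: survival_def)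
      qed
      then have "emeasure lborel {a<..<b} = 0"
        by (subst (asm) AE_iff_measurable[of "{a<..<b}"]) auto
      then show False using ab by simp
    qed
  qed measurable
  then have "ennreal (stop_loss A t) < ennreal (stop_loss B t)"
    by (simp only: stop_loss_nn_integral(1)[OF A] stop_loss_nn_integral(1)[OF B])
  then show ?thesis by (simp add: stop_loss_nonneg ennreal_less_iff)
qed

text \<open>The arguments are exchanged because the lower orthant order reverses the pointwise order
  of the copulas; comparability is symmetric, so this does no harm later.\<close>

lemma le_lo_imp_le_sl:
  assumes "A \<in> copulas" "B \<in> copulas" "le_lo A B"
  shows "le_sl B A"
  using assms by (auto simp: le_sl_iff le_lo_def intro!: stop_loss_mono)

subsection \<open>Modifying a copula near two corners\<close>

text \<open>This and the next copula are the upper and lower Frechet-Hoeffding bounds, with mass on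
  the diagonal and on the antidiagonal.\<close>

definition comonotone_copula :: "real \<times> real \<Rightarrow> real" where
  "comonotone_copula = restrict (\<lambda>(x, y). min x y) unit_square"

definition countermonotone_copula :: "real \<times> real \<Rightarrow> real" where
  "countermonotone_copula = restrict (\<lambda>(x, y). max (x + y - 1) 0) unit_square"

lemma
  assumes "x \<in> {0..1}" "y \<in> {0..1}"
  shows comonotone_copula_eq: "comonotone_copula (x, y) = min x y"
    and countermonotone_copula_eq: "countermonotone_copula (x, y) = max (x + y - 1) 0"
  using assms by (simp_all add: comonotone_copula_def countermonotone_copula_def)

lemma comonotone_copula: "comonotone_copula \<in> copulas"
  unfolding copulas_def comonotone_copula_def by (auto simp: min_def)

lemma countermonotone_copula: "countermonotone_copula \<in> copulas"
  unfolding copulas_def countermonotone_copula_def by (auto simp: max_def)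

text \<open>The ordinal sum of \<open>D\<close>, \<open>A\<close> and \<open>E\<close> with respect to the intervals \<open>[0, d]\<close>, \<open>[d, 1 - d]\<close>
  and \<open>[1 - d, 1]\<close>, written as a mixture of three rescaled copulas; this makes the rectangle
  inequality immediate.\<close>

definition lo_coord :: "real \<Rightarrow> real \<Rightarrow> real" where
  "lo_coord d x = min 1 (x / d)"

definition mid_coord :: "real \<Rightarrow> real \<Rightarrow> real" where
  "mid_coord d x = (max d (min (1 - d) x) - d) / (1 - 2 * d)"

definition hi_coord :: "real \<Rightarrow> real \<Rightarrow> real" where
  "hi_coord d x = max 0 ((x - 1 + d) / d)"

definition corner_patch ::
  "real \<Rightarrow> (real \<times> real \<Rightarrow> real) \<Rightarrow> (real \<times> real \<Rightarrow> real) \<Rightarrow> (real \<times> real \<Rightarrow> real) \<Rightarrow> real \<times> real \<Rightarrow> real"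
  where
  "corner_patch d D A E = restrict (\<lambda>(x, y). d * D (lo_coord d x, lo_coord d y)
     + (1 - 2 * d) * A (mid_coord d x, mid_coord d y) + d * E (hi_coord d x, hi_coord d y)) unit_square"

context
  fixes d :: real
  assumes d: "0 < d" "d < 1 / 2"
begin

lemma coord_range:
  assumes "x \<in> {0..1}"
  shows "lo_coord d x \<in> {0..1}" "mid_coord d x \<in> {0..1}" "hi_coord d x \<in> {0..1}"
  using assms d by (auto simp: lo_coord_def mid_coord_def hi_coord_def field_simps)

lemma coord_mono:
  assumes "x \<le> x'"
  shows "lo_coord d x \<le> lo_coord d x'" "mid_coord d x \<le> mid_coord d x'" "hi_coord d x \<le> hi_coord d x'"
proof -
  show "lo_coord d x \<le> lo_coord d x'"
    unfolding lo_coord_def using assms d by (intro min.mono divide_right_mono) auto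
  show "mid_coord d x \<le> mid_coord d x'"
    unfolding mid_coord_def using assms d by (intro divide_right_mono) auto
  show "hi_coord d x \<le> hi_coord d x'"
    unfolding hi_coord_def using assms d by (intro max.mono divide_right_mono) auto
qed

text \<open>This identity is what gives the mixture uniform marginals; it also bounds the distance
  between \<open>x\<close> and \<open>mid_coord d x\<close>.\<close>

lemma coord_sum:
  assumes "x \<in> {0..1}"
  shows "d * lo_coord d x + (1 - 2 * d) * mid_coord d x + d * hi_coord d x = x"
proof -
  have "d * lo_coord d x = min d x"
    using d by (simp add: lo_coord_def min_mult_distrib_left)
  moreover have "(1 - 2 * d) * mid_coord d x = max d (min (1 - d) x) - d"
    using d by (simp add: mid_coord_def)
  moreover have "d * hi_coord d x = max 0 (x - 1 + d)"
    using d by (simp add: hi_coord_def max_mult_distrib_left)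
  ultimately show ?thesis using assms d by auto
qed

lemma coord_lower:
  assumes "x \<le> d"
  shows "lo_coord d x = x / d" "mid_coord d x = 0" "hi_coord d x = 0"
  using assms d by (auto simp: lo_coord_def mid_coord_def hi_coord_def field_simps)

lemma coord_upper:
  assumes "1 - d \<le> x"
  shows "lo_coord d x = 1" "mid_coord d x = 1" "hi_coord d x = (x - 1 + d) / d"
  using assms d by (auto simp: lo_coord_def mid_coord_def hi_coord_def field_simps)

context
  fixes D A E :: "real \<times> real \<Rightarrow> real"
  assumes D: "D \<in> copulas" and A: "A \<in> copulas" and E: "E \<in> copulas"
begin

text \<open>On \<open>[0, d]^2\<close> the copulas \<open>A\<close> and \<open>E\<close> are
  evaluated at the origin and vanish.\<close>

lemma corner_patch_lower:
  assumes "x \<in> {0..d}" "y \<in> {0..d}"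
  shows "corner_patch d D A E (x, y) = d * D (x / d, y / d)"
  using assms d copula_boundary[OF A, of 0] copula_boundary[OF E, of 0]
  by (simp add: corner_patch_def coord_lower)

text \<open>Near the opposite corner \<open>D\<close> and \<open>A\<close> are evaluated at
  \<open>(1, 1)\<close> and contribute the constant \<open>d + (1 - 2 * d) = 1 - d\<close>.\<close>

lemma corner_patch_upper:
  assumes "x \<in> {1 - d..1}" "y \<in> {1 - d..1}"
  shows "corner_patch d D A E (x, y) = 1 - d + d * E ((x - 1 + d) / d, (y - 1 + d) / d)"
  using assms d copula_boundary[OF D, of 1] copula_boundary[OF A, of 1]
  by (simp add: corner_patch_def coord_upper)

lemma corner_patch_bounds:
  assumes "p \<in> unit_square"
  shows "corner_patch d D A E p \<in> {0..1}" "\<bar>A p - corner_patch d D A E p\<bar> \<le> 6 * d"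
proof -
  obtain x y where p: "p = (x, y)" "x \<in> {0..1}" "y \<in> {0..1}" using assms by auto
  have rg: "C (u, v) \<in> {0..1}" if "C \<in> copulas" "u \<in> {0..1}" "v \<in> {0..1}" for C u v
    using that by (auto simp: copulas_def PiE_iff)
  define a b c where "a = D (lo_coord d x, lo_coord d y)" and "b = A (mid_coord d x, mid_coord d y)"
    and "c = E (hi_coord d x, hi_coord d y)"
  have abc: "a \<in> {0..1}" "b \<in> {0..1}" "c \<in> {0..1}"
    unfolding a_def b_def c_def
    using rg[OF D coord_range(1)[OF p(2)] coord_range(1)[OF p(3)]]
      rg[OF A coord_range(2)[OF p(2)] coord_range(2)[OF p(3)]]
      rg[OF E coord_range(3)[OF p(2)] coord_range(3)[OF p(3)]] by blast+
  have eq: "corner_patch d D A E p = d * a + (1 - 2 * d) * b + d * c"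
    using p by (simp add: corner_patch_def a_def b_def c_def)
  \<comment> \<open>Used twice. For the coordinates it yields \<open>2 * d\<close> each, hence
    \<open>4 * d\<close> by the Lipschitz bound on \<open>A\<close>; for the copula values it yields
    another \<open>2 * d\<close>. Together these make the constant 6.\<close>
  have mix: "\<bar>d * r + (1 - 2 * d) * s + d * q - s\<bar> \<le> 2 * d"
    if "r \<in> {0..1}" "s \<in> {0..1}" "q \<in> {0..1}" for r s q
  proof -
    have "d * \<bar>r - s\<bar> \<le> d * 1" "d * \<bar>q - s\<bar> \<le> d * 1"
      using that d by (intro mult_left_mono; auto)+
    moreover have "d * r + (1 - 2 * d) * s + d * q - s = d * (r - s) + d * (q - s)"
      by (simp add: algebra_simps)
    ultimately show ?thesis
      using abs_triangle_ineq[of "d * (r - s)" "d * (q - s)"] d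
      unfolding abs_mult abs_of_pos[OF d(1)] by linarith
  qed
  have "d * a + (1 - 2 * d) * b + d * c \<le> d * 1 + (1 - 2 * d) * 1 + d * 1"
    using abc d by (intro add_mono mult_left_mono) auto
  moreover have "0 \<le> d * a + (1 - 2 * d) * b + d * c" using abc d by simp
  ultimately show "corner_patch d D A E p \<in> {0..1}" unfolding eq by simp
  have "\<bar>x - mid_coord d x\<bar> \<le> 2 * d" "\<bar>y - mid_coord d y\<bar> \<le> 2 * d"
    using mix[OF coord_range[OF p(2)]] mix[OF coord_range[OF p(3)]] coord_sum p by simp_all
  then have "\<bar>A (x, y) - b\<bar> \<le> 4 * d"
    unfolding b_def using copula_lipschitz[OF A coord_range(2)[OF p(2)] p(2) coord_range(2)[OF p(3)] p(3)]
    by linarith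
  then show "\<bar>A p - corner_patch d D A E p\<bar> \<le> 6 * d"
    using mix[OF abc] eq unfolding p(1) by linarith
qed

lemma corner_patch_copula: "corner_patch d D A E \<in> copulas"
proof -
  let ?P = "corner_patch d D A E"
  have "?P (t, 0) = 0 \<and> ?P (0, t) = 0 \<and> ?P (t, 1) = t \<and> ?P (1, t) = t" if t: "t \<in> {0..1}" for t
  proof -
    note [simp] = copula_boundary[OF D coord_range(1)[OF t]] copula_boundary[OF A coord_range(2)[OF t]]
      copula_boundary[OF E coord_range(3)[OF t]]
    have [simp]: "lo_coord d 0 = 0" "mid_coord d 0 = 0" "hi_coord d 0 = 0"
      "lo_coord d 1 = 1" "mid_coord d 1 = 1" "hi_coord d 1 = 1"
      using coord_lower[of 0] coord_upper[of 1] d by simp_all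
    show ?thesis using t coord_sum[OF t] by (simp add: corner_patch_def)
  qed
  moreover have "0 \<le> ?P (u', v') - ?P (u, v') - ?P (u', v) + ?P (u, v)"
    if uv: "u \<in> {0..1}" "u' \<in> {0..1}" "v \<in> {0..1}" "v' \<in> {0..1}" "u \<le> u'" "v \<le> v'" for u u' v v'
  proof -
    define V where "V C f = C (f u', f v') - C (f u, f v') - C (f u', f v) + C (f u, f v)"
      for C :: "real \<times> real \<Rightarrow> real" and f :: "real \<Rightarrow> real"
    have "0 \<le> V D (lo_coord d)" "0 \<le> V A (mid_coord d)" "0 \<le> V E (hi_coord d)"
      unfolding V_def using coord_range[OF uv(1)] coord_range[OF uv(2)] coord_range[OF uv(3)]
        coord_range[OF uv(4)] coord_mono[OF uv(5)] coord_mono[OF uv(6)]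
      by (auto intro!: copula_volume_nonneg D A E)
    then have "0 \<le> d * V D (lo_coord d) + (1 - 2 * d) * V A (mid_coord d) + d * V E (hi_coord d)"
      using d by (intro add_nonneg_nonneg mult_nonneg_nonneg) auto
    also have "\<dots> = ?P (u', v') - ?P (u, v') - ?P (u', v) + ?P (u, v)"
      using uv by (simp add: V_def corner_patch_def algebra_simps)
    finally show ?thesis .
  qed
  moreover have "?P \<in> unit_square \<rightarrow>\<^sub>E {0..1}"
    using corner_patch_bounds(1) by (intro PiE_I) (simp_all add: corner_patch_def)
  ultimately show ?thesis by (simp add: copulas_def)
qed

lemma copula_dist_corner_patch: "copula_dist A (corner_patch d D A E) \<le> 6 * d"
  using corner_patch_bounds(2) A corner_patch_copula
  by (auto simp: copula_dist_def intro!: cSUP_least)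

end

text \<open>The antidiagonal copula leaves no mass below the line \<open>x + y = d\<close>, respectively above
  \<open>x + y = 2 - d\<close>, while the diagonal copula does; so the two modified copulas are separated in
  opposite directions by the stop-loss transforms at \<open>d\<close> and \<open>2 - d\<close>.\<close>

lemma stop_loss_corner_patch_lower:
  assumes cop: "A \<in> copulas" "B \<in> copulas" "D \<in> copulas" "E \<in> copulas"
  shows "stop_loss (corner_patch d countermonotone_copula A D) d < stop_loss (corner_patch d comonotone_copula B E) d"
proof -
  let ?P = "corner_patch d countermonotone_copula A D" and ?Q = "corner_patch d comonotone_copula B E"
  have PQ: "?P \<in> copulas" "?Q \<in> copulas"
    using cop by (simp_all add: corner_patch_copula comonotone_copula countermonotone_copula)
  have val: "?P (s, d - s) = 0" "?Q (s, d - s) = min s (d - s)" if "s \<in> {0..d}" for s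
  proof -
    have uv: "s / d \<in> {0..1}" "(d - s) / d \<in> {0..1}" "s / d + (d - s) / d - 1 = 0"
      using that d by (auto simp: field_simps)
    have "d * min (s / d) ((d - s) / d) = min s (d - s)"
      using d by (simp add: min_mult_distrib_left)
    moreover have "s \<in> {0..d}" "d - s \<in> {0..d}" using that by auto
    ultimately show "?P (s, d - s) = 0" "?Q (s, d - s) = min s (d - s)"
      using uv(3) by (simp_all only: corner_patch_lower cop comonotone_copula countermonotone_copula
          comonotone_copula_eq[OF uv(1,2)] countermonotone_copula_eq[OF uv(1,2)])
  qed
  have in_triangle: "clamp01 s = s" "clamp01 (d - s) = d - s" if "s \<in> {0..d}" for s
    using that d by (auto simp: clamp01_def)
  show ?thesis
  proof (rule stop_loss_less[OF PQ])
    fix s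
    show "?P (clamp01 s, clamp01 (d - s)) \<le> ?Q (clamp01 s, clamp01 (d - s))"
    proof (cases "s \<in> {0..d}")
      case True
      then show ?thesis by (simp add: in_triangle val)
    next
      case False
      \<comment> \<open>Off the corner the clamped line runs along an axis, where every copula is
        0.\<close>
      then have "clamp01 s = 0 \<or> clamp01 (d - s) = 0" by (auto simp: clamp01_def)
      then show ?thesis using copula_boundary(1,2)[OF PQ(1)] copula_boundary(1,2)[OF PQ(2)] by auto
    qed
    show "?P (clamp01 s, clamp01 (d - s)) < ?Q (clamp01 s, clamp01 (d - s))" if "0 < s" "s < d"
      using that by (simp add: in_triangle val)
  qed (rule d)
qed

lemma stop_loss_corner_patch_upper:
  assumes cop: "A \<in> copulas" "B \<in> copulas" "D \<in> copulas" "E \<in> copulas"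
  shows "stop_loss (corner_patch d D A countermonotone_copula) (2 - d) < stop_loss (corner_patch d E B comonotone_copula) (2 - d)"
proof -
  let ?P = "corner_patch d D A countermonotone_copula" and ?Q = "corner_patch d E B comonotone_copula"
  have PQ: "?P \<in> copulas" "?Q \<in> copulas"
    using cop by (simp_all add: corner_patch_copula comonotone_copula countermonotone_copula)
  have val: "?P (s, 2 - d - s) = 1 - d" "?Q (s, 2 - d - s) = 1 - d + min (s - 1 + d) (1 - s)"
    if "s \<in> {1 - d..1}" for s
  proof -
    have uv: "(s - 1 + d) / d \<in> {0..1}" "(1 - s) / d \<in> {0..1}"
      "(s - 1 + d) / d + (1 - s) / d - 1 = 0"
      using that d by (auto simp: field_simps)
    have "d * min ((s - 1 + d) / d) ((1 - s) / d) = min (s - 1 + d) (1 - s)"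
      using d by (simp add: min_mult_distrib_left)
    moreover have "2 - d - s - 1 + d = 1 - s" by simp
    moreover have "s \<in> {1 - d..1}" "2 - d - s \<in> {1 - d..1}" using that by auto
    ultimately show "?P (s, 2 - d - s) = 1 - d" "?Q (s, 2 - d - s) = 1 - d + min (s - 1 + d) (1 - s)"
      using uv(3) by (simp_all only: corner_patch_upper cop comonotone_copula countermonotone_copula
          comonotone_copula_eq[OF uv(1,2)] countermonotone_copula_eq[OF uv(1,2)])
  qed
  have in_triangle: "clamp01 s = s" "clamp01 (2 - d - s) = 2 - d - s" if "s \<in> {1 - d..1}" for s
    using that d by (auto simp: clamp01_def)
  show ?thesis
  proof (rule stop_loss_less[OF PQ])
    fix s
    show "?P (clamp01 s, clamp01 (2 - d - s)) \<le> ?Q (clamp01 s, clamp01 (2 - d - s))"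
    proof (cases "s \<in> {1 - d..1}")
      case True
      then show ?thesis by (simp add: in_triangle val)
    next
      case False
      \<comment> \<open>Off the corner the clamped line runs along \<open>x = 1\<close> or
        \<open>y = 1\<close>, where all copulas agree.\<close>
      then have "clamp01 s = 1 \<or> clamp01 (2 - d - s) = 1" using d by (auto simp: clamp01_def)
      then show ?thesis using copula_boundary(3,4)[OF PQ(1)] copula_boundary(3,4)[OF PQ(2)] by auto
    qed
    show "?P (clamp01 s, clamp01 (2 - d - s)) < ?Q (clamp01 s, clamp01 (2 - d - s))"
      if "1 - d < s" "s < 1"
      using that by (simp add: in_triangle val)
  qed (use d in simp)
qed

end

lemma corner_patches_incomparable:
  assumes "0 < d" "d < 1 / 2" "A \<in> copulas" "B \<in> copulas"
  shows "\<not> le_sl (corner_patch d comonotone_copula A countermonotone_copula) (corner_patch d countermonotone_copula B comonotone_copula)"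
    and "\<not> le_sl (corner_patch d countermonotone_copula B comonotone_copula) (corner_patch d comonotone_copula A countermonotone_copula)"
  using stop_loss_corner_patch_lower[of d B A comonotone_copula countermonotone_copula]
    stop_loss_corner_patch_upper[of d A B comonotone_copula countermonotone_copula] assms comonotone_copula countermonotone_copula
  by (auto simp: le_sl_iff not_le)

subsection \<open>Continuity of integrals of continuous functions\<close>

lemma copula_dist_upper:
  assumes "A \<in> copulas" "B \<in> copulas" "p \<in> unit_square"
  shows "\<bar>A p - B p\<bar> \<le> copula_dist A B"
proof -
  have "bdd_above ((\<lambda>p. \<bar>A p - B p\<bar>) ` unit_square)"
  proof (rule bdd_aboveI2)
    fix q :: "real \<times> real" assume "q \<in> unit_square"
    then have "A q \<in> {0..1}" "B q \<in> {0..1}"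
      using assms by (auto simp: copulas_def PiE_iff)
    then show "\<bar>A q - B q\<bar> \<le> 1" by auto
  qed
  then show ?thesis
    using cSUP_upper[OF assms(3)] assms by (simp add: copula_dist_def)
qed

text \<open>The rectangle is a difference of differences of nested lower left orthants. Half-open
  sides let the grid cells below be disjoint.\<close>

lemma copula_measure_rectangle:
  assumes C: "C \<in> copulas" and ab: "a \<le> b" "c \<le> e"
  shows "{p \<in> unit_square. (a < fst p \<and> fst p \<le> b) \<and> (c < snd p \<and> snd p \<le> e)} \<in> sets (copula_measure C)"
    (is "?R \<in> _")
    and "measure (copula_measure C)
        {p \<in> unit_square. (a < fst p \<and> fst p \<le> b) \<and> (c < snd p \<and> snd p \<le> e)} =
      C (clamp01 b, clamp01 e) - C (clamp01 a, clamp01 e) - C (clamp01 b, clamp01 c) + C (clamp01 a, clamp01 c)"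
proof -
  let ?M = "copula_measure C"
  interpret prob_space ?M by (rule prob_space_copula_measure[OF C])
  note space = space_copula_measure[OF C]
  note [measurable] = borel_measurable_copula_coordinates[OF C]
  define H where "H x y = {p \<in> unit_square. fst p \<le> x \<and> snd p \<le> y}" for x y :: real
  have H: "H x y \<in> events" for x y
    unfolding H_def space[symmetric] by measurable
  have m: "prob (H x y) = C (clamp01 x, clamp01 y)" for x y
    unfolding H_def by (rule copula_measure_cdf[OF C])
  have d1: "prob (H b y - H a y) = prob (H b y) - prob (H a y)" for y
    using ab by (intro finite_measure_Diff H) (auto simp: H_def)
  have d2: "prob ((H b e - H a e) - (H b c - H a c)) = prob (H b e - H a e) - prob (H b c - H a c)"
    using ab by (intro finite_measure_Diff sets.Diff H) (auto simp: H_def)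
  have R: "?R = (H b e - H a e) - (H b c - H a c)"
    using ab by (auto simp: H_def)
  show "?R \<in> events" unfolding R by (intro sets.Diff H)
  show "prob ?R = C (clamp01 b, clamp01 e) - C (clamp01 a, clamp01 e) - C (clamp01 b, clamp01 c)
      + C (clamp01 a, clamp01 c)"
    unfolding R d2 d1 m by simp
qed

text \<open>Index 0 stands for the interval from \<open>-1 / n\<close> to 0, which collects the
  points on the edge; hence each index runs over the \<open>n + 1\<close> values up to
  \<open>n\<close>.\<close>

definition grid_cell :: "nat \<Rightarrow> nat \<times> nat \<Rightarrow> (real \<times> real) set" where
  "grid_cell n = (\<lambda>(i, j). {p \<in> unit_square.
     ((real i - 1) / n < fst p \<and> fst p \<le> i / n) \<and> ((real j - 1) / n < snd p \<and> snd p \<le> j / n)})"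

lemma grid_interval_iff:
  assumes "0 < n" "x \<in> {0..1}"
  shows "(real i - 1) / real n < x \<and> x \<le> i / real n \<longleftrightarrow> i = nat \<lceil>n * x\<rceil>"
proof -
  have "(real i - 1) / real n < x \<and> x \<le> i / real n \<longleftrightarrow> real i - 1 < n * x \<and> n * x \<le> real i"
    using assms by (simp add: field_simps)
  also have "\<dots> \<longleftrightarrow> \<lceil>n * x\<rceil> = int i"
    by (simp add: ceiling_eq_iff)
  also have "\<dots> \<longleftrightarrow> i = nat \<lceil>n * x\<rceil>"
  proof -
    have "0 \<le> real n * x" using assms by simp
    then have "0 \<le> \<lceil>n * x\<rceil>" by linarith
    then show ?thesis by auto
  qed
  finally show ?thesis .
qed

lemma sum_grid_cells:
  assumes n: "0 < n" and p: "p \<in> unit_square"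
  shows "(\<Sum>q\<in>{..n} \<times> {..n}. indicator (grid_cell n q) p) = (1::real)"
proof -
  let ?q = "(nat \<lceil>n * fst p\<rceil>, nat \<lceil>n * snd p\<rceil>)"
  have p': "fst p \<in> {0..1}" "snd p \<in> {0..1}" using p by auto
  have "p \<in> grid_cell n q \<longleftrightarrow> q = ?q" for q
    unfolding grid_cell_def case_prod_unfold mem_Collect_eq
    using p by (simp only: grid_interval_iff[OF n p'(1)] grid_interval_iff[OF n p'(2)] prod_eq_iff) auto
  then have "(\<Sum>q\<in>{..n} \<times> {..n}. indicator (grid_cell n q) p) = (\<Sum>q\<in>{..n} \<times> {..n}. if q = ?q then 1 else (0::real))"
    by (intro sum.cong) (auto simp: indicator_def)
  also have "nat \<lceil>n * x\<rceil> \<le> n" if "x \<in> {0..1}" for x :: real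
  proof -
    have "real n * x \<le> real n * 1" using that by (intro mult_left_mono) auto
    then show ?thesis by (simp add: nat_le_iff ceiling_le_iff)
  qed
  from this[OF p'(1)] this[OF p'(2)]
  have "(\<Sum>q\<in>{..n} \<times> {..n}. if q = ?q then 1 else (0::real)) = 1" by simp
  finally show ?thesis .
qed

text \<open>A step function on a grid approximates \<open>f\<close> uniformly, and its integral is a
  finite combination of rectangle masses. Each mass involves four copula values, so it moves by at
  most four times the distance of the copulas. The error \<open>e\<close> is split into thirds: one
  step approximation for \<open>A\<close>, one for \<open>B\<close>, and the change of the finite
  sum.\<close>

lemma integral_copula_measure_continuous:
  fixes f :: "real \<times> real \<Rightarrow> real"
  assumes f: "continuous_on unit_square f" and e: "0 < e"
  obtains \<eta> where "0 < \<eta>" "\<And>A B. A \<in> copulas \<Longrightarrow> B \<in> copulas \<Longrightarrow> copula_dist A B < \<eta> \<Longrightarrow>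
    \<bar>(\<integral>p. f p \<partial>copula_measure A) - (\<integral>p. f p \<partial>copula_measure B)\<bar> < e"
proof -
  have comp: "compact unit_square" by (intro compact_Times compact_Icc)
  have "uniformly_continuous_on unit_square f"
    by (rule compact_uniformly_continuous[OF f comp])
  then obtain d where d: "0 < d" "\<And>p q. p \<in> unit_square \<Longrightarrow> q \<in> unit_square \<Longrightarrow> dist q p < d \<Longrightarrow>
      dist (f q) (f p) < e / 3"
    using e unfolding uniformly_continuous_on_def by (metis divide_pos_pos zero_less_numeral)
  \<comment> \<open>A point differs from the upper right corner of its cell by at most
    \<open>1 / n\<close> in each coordinate, so by at most \<open>2 / n\<close> in distance.\<close>
  obtain n :: nat where n: "2 / d < n" using reals_Archimedean2 by blast
  have n0: "0 < n" using n d(1) by (metis of_nat_0_less_iff order_less_trans divide_pos_pos zero_less_numeral)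
  have nd: "2 / n < d" using n d(1) n0 by (simp add: field_simps)
  obtain K where K: "0 < K" "\<And>p. p \<in> unit_square \<Longrightarrow> \<bar>f p\<bar> \<le> K"
    using compact_imp_bounded[OF compact_continuous_image[OF f comp]]
    unfolding bounded_pos by (auto simp: image_iff)
  define G where "G = {..n} \<times> {..n}"
  define v where "v q = f (real (fst q) / n, real (snd q) / n)" for q :: "nat \<times> nat"
  define g where "g p = (\<Sum>q\<in>G. v q * indicator (grid_cell n q) p)" for p
  have corner: "(real (fst q) / n, real (snd q) / n) \<in> unit_square" if "q \<in> G" for q
    using that n0 by (auto simp: G_def)
  have fg: "\<bar>f p - g p\<bar> \<le> e / 3" if p: "p \<in> unit_square" for p
  proof -
    have one: "(\<Sum>q\<in>G. indicator (grid_cell n q) p) = (1::real)"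
      unfolding G_def by (rule sum_grid_cells[OF n0 p])
    have "f p - g p = (\<Sum>q\<in>G. f p * indicator (grid_cell n q) p) - g p"
      by (simp only: sum_distrib_left[symmetric] one mult_1_right)
    also have "\<dots> = (\<Sum>q\<in>G. (f p - v q) * indicator (grid_cell n q) p)"
      by (simp add: g_def sum_subtractf left_diff_distrib)
    also have "\<bar>\<dots>\<bar> \<le> (\<Sum>q\<in>G. \<bar>(f p - v q) * indicator (grid_cell n q) p\<bar>)" by (rule sum_abs)
    also have "\<dots> \<le> (\<Sum>q\<in>G. e / 3 * indicator (grid_cell n q) p)"
    proof (rule sum_mono)
      fix q assume q: "q \<in> G"
      show "\<bar>(f p - v q) * indicator (grid_cell n q) p\<bar> \<le> e / 3 * indicator (grid_cell n q) p"
      proof (cases "p \<in> grid_cell n q")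
        case True
        have "\<bar>fst p - real (fst q) / n\<bar> \<le> 1 / n" "\<bar>snd p - real (snd q) / n\<bar> \<le> 1 / n"
          using True n0 by (auto simp: grid_cell_def case_prod_unfold diff_divide_distrib abs_le_iff)
        moreover have "dist p (real (fst q) / n, real (snd q) / n) \<le> \<bar>fst p - real (fst q) / n\<bar> + \<bar>snd p - real (snd q) / n\<bar>"
          unfolding dist_prod_def dist_real_def fst_conv snd_conv
          using sqrt_sum_squares_le_sum_abs[of "\<bar>fst p - real (fst q) / n\<bar>" "\<bar>snd p - real (snd q) / n\<bar>"] by simp
        ultimately have "dist p (real (fst q) / n, real (snd q) / n) < d"
          using nd by linarith
        then have "\<bar>f p - v q\<bar> < e / 3"
          using d(2)[OF corner[OF q] p] by (simp add: v_def dist_real_def)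
        then show ?thesis using True by simp
      qed simp
    qed
    also have "\<dots> = e / 3" by (simp only: sum_distrib_left[symmetric] one mult_1_right)
    finally show ?thesis .
  qed
  \<comment> \<open>The sum over the cells of the bound \<open>K\<close> on \<open>f\<close> times
    the four corners; \<open>N + 1\<close> in \<open>\<eta>\<close> keeps the quotient defined and
    makes the final estimate strict.\<close>
  define N where "N = (\<Sum>q\<in>G. K * 4)"
  have N: "0 \<le> N" using K(1) by (simp add: N_def sum_nonneg)
  define \<eta> where "\<eta> = e / (3 * (N + 1))"
  have int_f: "\<bar>(\<integral>p. f p \<partial>copula_measure C) - (\<Sum>q\<in>G. v q * measure (copula_measure C) (grid_cell n q))\<bar> \<le> e / 3"
    if C: "C \<in> copulas" for C
  proof -
    let ?M = "copula_measure C"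
    interpret prob_space ?M by (rule prob_space_copula_measure[OF C])
    note space = space_copula_measure[OF C]
    have cell: "grid_cell n q \<in> events" for q
      unfolding grid_cell_def case_prod_unfold
      by (intro copula_measure_rectangle(1)[OF C] divide_right_mono) auto
    have fm: "f \<in> borel_measurable ?M" by (rule borel_measurable_copula_measure(2)[OF C f])
    have fi: "integrable ?M f"
      using K(2) by (intro integrable_const_bound[where B = K, OF _ fm]) (auto simp: space)
    have ind: "integrable ?M (indicat_real (grid_cell n q))" for q
      by (rule integrable_real_indicator[OF cell]) (simp add: emeasure_eq_measure)
    have gi: "integrable ?M g"
      unfolding g_def by (intro Bochner_Integration.integrable_sum integrable_mult_right ind)
    have "(\<integral>p. g p \<partial>?M) = (\<Sum>q\<in>G. v q * prob (grid_cell n q))"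
      unfolding g_def using sets.Int_space_eq2[OF cell]
      by (subst Bochner_Integration.integral_sum) (auto intro!: integrable_mult_right ind)
    then have "(\<integral>p. f p \<partial>?M) - (\<Sum>q\<in>G. v q * prob (grid_cell n q)) = (\<integral>p. f p - g p \<partial>?M)"
      using fi gi by simp
    also have "\<bar>\<dots>\<bar> \<le> (\<integral>p. \<bar>f p - g p\<bar> \<partial>?M)" by (rule integral_abs_bound)
    also have "\<dots> \<le> (\<integral>p. e / 3 \<partial>?M)"
      using fg fi gi by (intro integral_mono) (auto simp: space)
    finally show ?thesis by (simp add: prob_space)
  qed
  show ?thesis
  proof
    show "0 < \<eta>" using e N by (simp add: \<eta>_def)
    fix A B assume A: "A \<in> copulas" and B: "B \<in> copulas" and AB: "copula_dist A B < \<eta>"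
    let ?m = "\<lambda>C q. measure (copula_measure C) (grid_cell n q)"
    have "\<bar>?m A q - ?m B q\<bar> \<le> 4 * copula_dist A B" for q
    proof -
      define D where "D x y = A (clamp01 x, clamp01 y) - B (clamp01 x, clamp01 y)" for x y
      have D: "\<bar>D x y\<bar> \<le> copula_dist A B" for x y
        unfolding D_def by (rule copula_dist_upper[OF A B]) simp
      have le: "(real k - 1) / n \<le> k / n" for k by (intro divide_right_mono) auto
      have "?m A q - ?m B q = D (real (fst q) / n) (real (snd q) / n) - D ((real (fst q) - 1) / n) (real (snd q) / n)
          - D (real (fst q) / n) ((real (snd q) - 1) / n) + D ((real (fst q) - 1) / n) ((real (snd q) - 1) / n)"
        unfolding grid_cell_def case_prod_unfold copula_measure_rectangle(2)[OF A le le]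
          copula_measure_rectangle(2)[OF B le le] D_def by simp
      then show ?thesis
        using D[of "real (fst q) / n" "real (snd q) / n"] D[of "(real (fst q) - 1) / n" "real (snd q) / n"]
          D[of "real (fst q) / n" "(real (snd q) - 1) / n"] D[of "(real (fst q) - 1) / n" "(real (snd q) - 1) / n"]
        by linarith
    qed
    then have "\<bar>v q * (?m A q - ?m B q)\<bar> \<le> K * (4 * copula_dist A B)" if "q \<in> G" for q
      unfolding abs_mult v_def using K(2)[OF corner[OF that]] K(1) by (intro mult_mono) auto
    then have "(\<Sum>q\<in>G. \<bar>v q * (?m A q - ?m B q)\<bar>) \<le> (\<Sum>q\<in>G. K * (4 * copula_dist A B))"
      by (rule sum_mono)
    also have "\<dots> = N * copula_dist A B" by (simp add: N_def sum_distrib_right)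
    also have "\<dots> \<le> N * \<eta>" using AB N by (intro mult_left_mono) auto
    also have "\<dots> < e / 3"
    proof -
      have "N * \<eta> = e / 3 * (N / (N + 1))" by (simp add: \<eta>_def)
      also have "\<dots> < e / 3 * 1" using e N by (intro mult_strict_left_mono) (auto simp: field_simps)
      finally show ?thesis by simp
    qed
    finally have "\<bar>(\<Sum>q\<in>G. v q * ?m A q) - (\<Sum>q\<in>G. v q * ?m B q)\<bar> < e / 3"
      using sum_abs[of "\<lambda>q. v q * (?m A q - ?m B q)" G]
      by (simp add: right_diff_distrib sum_subtractf)
    then show "\<bar>(\<integral>p. f p \<partial>copula_measure A) - (\<integral>p. f p \<partial>copula_measure B)\<bar> < e"
      using int_f[OF A] int_f[OF B] by linarith
  qed
qed

subsection \<open>Convex functions on the square\<close>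

text \<open>Above, by the maximum at the four corners, interpolating first along two edges and then
  between them. Below, by reflecting the point in the centre, which is the midpoint of the
  two.\<close>

lemma convex_on_square_bounded:
  assumes f: "convex_on unit_square f"
  obtains K :: real where "\<And>p. p \<in> unit_square \<Longrightarrow> \<bar>f p\<bar> \<le> K"
proof -
  define U where "U = max (max (f (0, 0)) (f (1, 0))) (max (f (0, 1)) (f (1, 1)))"
  have mix: "(1 - t) * a + t * b \<le> c" if "0 \<le> t" "t \<le> 1" "a \<le> c" "b \<le> c" for t a b c :: real
    using that convex_bound_le[of a c b "1 - t" t] by simp
  have upper: "f p \<le> U" if p: "p \<in> unit_square" for p
  proof -
    obtain x y where xy: "p = (x, y)" "0 \<le> x" "x \<le> 1" "0 \<le> y" "y \<le> 1" using p by auto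
    have edge: "f (x, b) \<le> U" if "b = 0 \<or> b = 1" for b
    proof -
      have "f (x, b) \<le> (1 - x) * f (0, b) + x * f (1, b)"
        using convex_onD[OF f, of x "(0, b)" "(1, b)"] xy that by (auto simp: algebra_simps)
      also have "\<dots> \<le> U" using that xy by (intro mix) (auto simp: U_def)
      finally show ?thesis .
    qed
    have "f (x, y) \<le> (1 - y) * f (x, 0) + y * f (x, 1)"
      using convex_onD[OF f, of y "(x, 0)" "(x, 1)"] xy by (auto simp: algebra_simps)
    also have "\<dots> \<le> U" using edge xy by (intro mix) auto
    finally show ?thesis by (simp add: xy)
  qed
  have lower: "2 * f (1 / 2, 1 / 2) - U \<le> f p" if p: "p \<in> unit_square" for p
  proof -
    obtain x y where xy: "p = (x, y)" "0 \<le> x" "x \<le> 1" "0 \<le> y" "y \<le> 1" using p by auto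
    have mid: "(1 - 1 / 2) *\<^sub>R (x, y) + (1 / 2) *\<^sub>R (1 - x, 1 - y) = (1 / 2, 1 / 2)"
      by (simp add: field_simps)
    then have "f (1 / 2, 1 / 2) \<le> (1 - 1 / 2) * f (x, y) + 1 / 2 * f (1 - x, 1 - y)"
      using convex_onD[OF f, of "1 / 2" "(x, y)" "(1 - x, 1 - y)", unfolded mid] xy by simp
    then show ?thesis using upper[of "(1 - x, 1 - y)"] xy by simp
  qed
  show ?thesis
  proof
    fix p :: "real \<times> real" assume "p \<in> unit_square"
    then show "\<bar>f p\<bar> \<le> \<bar>U\<bar> + \<bar>2 * f (1 / 2, 1 / 2) - U\<bar>"
      using upper[of p] lower[of p] by linarith
  qed
qed

lemma unit_interval_extend:
  fixes x :: real
  assumes "x \<in> {0..1}"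
  obtains e where "0 < e" "\<And>y k. y \<in> {0..1} \<Longrightarrow> 0 \<le> k \<Longrightarrow> k * \<bar>y - x\<bar> \<le> e \<Longrightarrow> x + k * (y - x) \<in> {0..1}"
proof -
  \<comment> \<open>At an endpoint every move towards a point of the interval goes inward, so length
    1 is available; elsewhere the distance to the nearer end limits the move.\<close>
  define e where "e = (if x = 0 \<or> x = 1 then 1 else min x (1 - x))"
  show ?thesis
  proof
    show "0 < e" using assms by (auto simp: e_def)
    fix y k :: real assume y: "y \<in> {0..1}" and k: "0 \<le> k" "k * \<bar>y - x\<bar> \<le> e"
    have "\<bar>k * (y - x)\<bar> \<le> e" using k by (simp add: abs_mult)
    moreover have "x = 0 \<Longrightarrow> 0 \<le> k * (y - x)" "x = 1 \<Longrightarrow> k * (y - x) \<le> 0"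
      using y k by (auto simp: mult_nonneg_nonpos)
    ultimately show "x + k * (y - x) \<in> {0..1}"
      using assms by (auto simp: e_def split: if_splits)
  qed
qed

text \<open>A convex function on a square is upper semicontinuous even at the boundary, since every
  point of the square near \<open>p\<close> lies on a segment of definite length that starts in \<open>p\<close>.\<close>

lemma convex_on_square_openin_sublevel:
  assumes f: "convex_on unit_square f"
  shows "openin (top_of_set unit_square) {p \<in> unit_square. f p < a}"
proof (subst openin_contains_ball, safe)
  fix x y :: real assume p: "x \<in> {0..1}" "y \<in> {0..1}" "f (x, y) < a"
  obtain K where K: "\<And>p. p \<in> unit_square \<Longrightarrow> \<bar>f p\<bar> \<le> K" using convex_on_square_bounded[OF f] by blast
  have K0: "0 \<le> K" using K[of "(0, 0)"] by simp
  obtain ex where ex: "0 < ex" "\<And>z k. z \<in> {0..1} \<Longrightarrow> 0 \<le> k \<Longrightarrow> k * \<bar>z - x\<bar> \<le> ex \<Longrightarrow> x + k * (z - x) \<in> {0..1}"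
    using unit_interval_extend[OF p(1)] by blast
  obtain ey where ey: "0 < ey" "\<And>z k. z \<in> {0..1} \<Longrightarrow> 0 \<le> k \<Longrightarrow> k * \<bar>z - y\<bar> \<le> ey \<Longrightarrow> y + k * (z - y) \<in> {0..1}"
    using unit_interval_extend[OF p(2)] by blast
  \<comment> \<open>A convex combination with weight \<open>s\<close> on a second point of the
    square raises the value by at most \<open>s * (2 * K)\<close>, which must stay below
    \<open>a - f (x, y)\<close>; the summand 1 covers \<open>K = 0\<close>.\<close>
  define s where "s = min 1 ((a - f (x, y)) / (2 * K + 1))"
  define e where "e = min ex ey"
  have s: "0 < s" "s \<le> 1" "s * (2 * K) < a - f (x, y)"
  proof -
    show "0 < s" "s \<le> 1" using p K0 by (simp_all add: s_def)
    have "s * (2 * K) < s * (2 * K + 1)" using \<open>0 < s\<close> by simp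
    also have "\<dots> \<le> (a - f (x, y)) / (2 * K + 1) * (2 * K + 1)"
      using K0 by (intro mult_right_mono) (auto simp: s_def)
    finally show "s * (2 * K) < a - f (x, y)" using K0 by simp
  qed
  have "f (u, v) < a" if uv: "u \<in> {0..1}" "v \<in> {0..1}" "dist (x, y) (u, v) < s * e" for u v
  proof -
    have "\<bar>u - x\<bar> \<le> s * e" "\<bar>v - y\<bar> \<le> s * e"
      using uv(3) dist_fst_le[of "(x, y)" "(u, v)"] dist_snd_le[of "(x, y)" "(u, v)"]
      by (auto simp: dist_real_def)
    then have "1 / s * \<bar>u - x\<bar> \<le> e" "1 / s * \<bar>v - y\<bar> \<le> e"
      using s(1) by (simp_all add: field_simps)
    then have r: "x + 1 / s * (u - x) \<in> {0..1}" "y + 1 / s * (v - y) \<in> {0..1}"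
      using s(1) uv by (auto simp: e_def simp del: atLeastAtMost_iff times_divide_eq_left intro!: ex(2) ey(2))
    \<comment> \<open>The point reached by stretching the segment from \<open>(x, y)\<close> to
      \<open>(u, v)\<close> by the factor \<open>1 / s\<close>; it stays in the square because
      \<open>(u, v)\<close> is closer than \<open>s * e\<close>.\<close>
    define r where "r = (x + 1 / s * (u - x), y + 1 / s * (v - y))"
    have rs: "r \<in> unit_square" using r by (simp add: r_def)
    have "(1 - s) * b + s * (b + 1 / s * (c - b)) = c" for b c
      using s(1) by (simp add: distrib_left left_diff_distrib)
    then have "(1 - s) *\<^sub>R (x, y) + s *\<^sub>R r = (u, v)"
      by (simp only: r_def scaleR_Pair real_scaleR_def add_Pair)
    then have "f (u, v) \<le> (1 - s) * f (x, y) + s * f r"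
      using convex_onD[OF f, of s "(x, y)" r] s(1,2) p rs by simp
    also have "\<dots> = f (x, y) + s * (f r - f (x, y))" by (simp add: algebra_simps)
    also have "\<dots> \<le> f (x, y) + s * (2 * K)"
      using K[OF rs] K[of "(x, y)"] p s(1) by (intro add_left_mono mult_left_mono) (auto simp: abs_le_iff)
    also have "\<dots> < a" using s(3) by simp
    finally show ?thesis .
  qed
  moreover have "0 < s * e" using s ex ey by (simp add: e_def)
  ultimately show "\<exists>e>0. ball (x, y) e \<inter> unit_square \<subseteq> {p \<in> unit_square. f p < a}"
    by (intro exI[of _ "s * e"]) auto
qed

lemma borel_measurable_convex_on_square:
  assumes C: "C \<in> copulas" and f: "convex_on unit_square f"
  shows "f \<in> borel_measurable (copula_measure C)"
proof -
  have "{p \<in> unit_square. f p < a} \<in> sets (restrict_space borel unit_square)" for a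
  proof -
    obtain T where "open T" "{p \<in> unit_square. f p < a} = unit_square \<inter> T"
      using convex_on_square_openin_sublevel[OF f, of a] by (auto simp: openin_open)
    then show ?thesis by (auto simp: sets_restrict_space)
  qed
  then show ?thesis
    by (simp add: borel_measurable_iff_less sets_copula_measure[OF C] space_copula_measure[OF C])
qed

section \<open>Continuous approximation of convex functions by contraction\<close>

definition contract :: "nat \<Rightarrow> real \<times> real \<Rightarrow> real \<times> real" where
  "contract n p = (1 / real (n + 2)) *\<^sub>R (1 / 2, 1 / 2) + (1 - 1 / real (n + 2)) *\<^sub>R p"

lemma contract_interior:
  assumes "p \<in> unit_square"
  shows "contract n p \<in> {0<..<1} \<times> {0<..<1}"
proof -
  \<comment> \<open>The offset 2 keeps the weight of the centre strictly between 0 and 1 already for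
    \<open>n = 0\<close>.\<close>
  define r where "r = 1 / real (n + 2)"
  have r: "0 < r" "r < 1" by (simp_all add: r_def)
  have "r * (1 / 2) + (1 - r) * x \<in> {0<..<1}" if "x \<in> {0..1}" for x
  proof -
    have "r * (1 / 2) + (1 - r) * x < r * 1 + (1 - r) * 1"
      using that r by (intro add_less_le_mono mult_strict_left_mono mult_left_mono) auto
    moreover have "0 < r * (1 / 2) + (1 - r) * x" using that r by (intro add_pos_nonneg) auto
    ultimately show ?thesis by simp
  qed
  then show ?thesis using assms unfolding contract_def r_def[symmetric] by (cases p) auto
qed

lemma contract_tendsto: "(\<lambda>n. contract n p) \<longlonglongrightarrow> p"
proof -
  have "(\<lambda>n. 1 / real (n + 2)) \<longlonglongrightarrow> 0"
    using LIMSEQ_ignore_initial_segment[OF lim_1_over_n, of 2] by simp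
  then have "(\<lambda>n. contract n p) \<longlonglongrightarrow> 0 *\<^sub>R (1 / 2, 1 / 2) + (1 - 0) *\<^sub>R p"
    unfolding contract_def by (intro tendsto_intros)
  then show ?thesis by (simp flip: zero_prod_def)
qed

lemma continuous_on_convex_interior:
  assumes "convex_on unit_square f"
  shows "continuous_on ({0<..<1} \<times> {0<..<1}) f"
  using assms by (intro convex_on_continuous open_Times convex_on_subset[OF assms])
    (auto intro: convex_Times)

lemma continuous_on_contract:
  assumes f: "convex_on unit_square f"
  shows "continuous_on unit_square (\<lambda>p. f (contract n p))"
proof (rule continuous_on_compose2[OF continuous_on_convex_interior[OF f]])
  show "continuous_on unit_square (contract n)"
    unfolding contract_def by (intro continuous_intros)
qed (use contract_interior in blast)

lemma convex_on_contract:
  assumes f: "convex_on unit_square f"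
  shows "convex_on unit_square (\<lambda>p. f (contract n p))"
proof (rule convex_onI)
  show "convex unit_square" using f by (rule convex_on_imp_convex)
  fix t :: real and p q :: "real \<times> real" assume t: "0 < t" "t < 1" and pq: "p \<in> unit_square" "q \<in> unit_square"
  have "contract n ((1 - t) *\<^sub>R p + t *\<^sub>R q) = (1 - t) *\<^sub>R contract n p + t *\<^sub>R contract n q"
  proof -
    have "r *\<^sub>R c + (1 - r) *\<^sub>R ((1 - t) *\<^sub>R p + t *\<^sub>R q) =
        (1 - t) *\<^sub>R (r *\<^sub>R c + (1 - r) *\<^sub>R p) + t *\<^sub>R (r *\<^sub>R c + (1 - r) *\<^sub>R q)" for r c
      by (simp add: algebra_simps)
    then show ?thesis unfolding contract_def .
  qed
  moreover have "contract n p \<in> unit_square" "contract n q \<in> unit_square"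
    using contract_interior[OF pq(1), of n] contract_interior[OF pq(2), of n] by (auto simp: mem_Times_iff)
  ultimately show "f (contract n ((1 - t) *\<^sub>R p + t *\<^sub>R q)) \<le> (1 - t) * f (contract n p) + t * f (contract n q)"
    using convex_onD[OF f, of t] t by simp
qed

text \<open>A convex function may jump at the boundary of the square, so convergence along
  contractions is guaranteed only inside. The boundary is null because the marginals are uniform:
  the square from \<open>r\<close> to \<open>1 - r\<close> has mass at least
  \<open>(1 - 2 * r) - r - r + 0\<close>.\<close>

lemma AE_copula_measure_interior:
  assumes C: "C \<in> copulas"
  shows "AE p in copula_measure C. p \<in> {0<..<1} \<times> {0<..<1}"
proof -
  let ?M = "copula_measure C"
  interpret prob_space ?M by (rule prob_space_copula_measure[OF C])
  note space = space_copula_measure[OF C]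
  have "prob {p \<in> unit_square. (r < fst p \<and> fst p \<le> 1 - r) \<and> (r < snd p \<and> snd p \<le> 1 - r)} \<ge> 1 - 4 * r"
    if "0 < r" "r < 1 / 2" for r
  proof -
    have "clamp01 r = r" "clamp01 (1 - r) = 1 - r" using that by (auto simp: clamp01_def)
    moreover have "1 - 2 * r \<le> C (1 - r, 1 - r)"
      using copula_upper_lipschitz[OF C, of "1 - r" 1 "1 - r" 1] copula_boundary[OF C, of 1] that by simp
    moreover have "C (r, 1 - r) \<le> r" "C (1 - r, r) \<le> r" "0 \<le> C (r, r)"
      using copula_mono[OF C, of r r "1 - r" 1] copula_mono[OF C, of "1 - r" 1 r r]
        copula_mono[OF C, of 0 r 0 r] copula_boundary[OF C, of r] copula_boundary[OF C, of 0] that by simp_all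
    moreover have "r \<le> 1 - r" using that by simp
    ultimately show ?thesis
      unfolding copula_measure_rectangle(2)[OF C \<open>r \<le> 1 - r\<close> \<open>r \<le> 1 - r\<close>] by simp
  qed
  moreover have int: "{0<..<1} \<times> {0<..<1} \<in> events"
    by (auto simp: sets_copula_measure[OF C] sets_restrict_space_iff borel_prod[symmetric])
  moreover have "prob {p \<in> unit_square. (r < fst p \<and> fst p \<le> 1 - r) \<and> (r < snd p \<and> snd p \<le> 1 - r)}
      \<le> prob ({0<..<1} \<times> {0<..<1})" if "0 < r" for r
    using that int by (intro finite_measure_mono) auto
  ultimately have ge: "1 - 4 * r \<le> prob ({0<..<1} \<times> {0<..<1})" if "0 < r" "r < 1 / 2" for r
    using that by (meson order_trans)
  have "1 \<le> prob ({0<..<1} \<times> {0<..<1})"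
  proof (rule field_le_epsilon)
    fix e :: real assume e: "0 < e"
    define r where "r = min (1 / 4) (e / 4)"
    have "0 < r" "r < 1 / 2" "4 * r \<le> e" using e by (auto simp: r_def)
    then show "1 \<le> prob ({0<..<1} \<times> {0<..<1}) + e"
      using ge[of r] by linarith
  qed
  then have "prob ({0<..<1} \<times> {0<..<1}) = 1" by (simp add: antisym)
  then show ?thesis using prob_eq_1[OF int] by simp
qed

lemma integral_contract_tendsto:
  assumes C: "C \<in> copulas" and f: "convex_on unit_square f"
  shows "(\<lambda>n. \<integral>p. f (contract n p) \<partial>copula_measure C) \<longlonglongrightarrow> (\<integral>p. f p \<partial>copula_measure C)"
proof -
  interpret prob_space "copula_measure C" by (rule prob_space_copula_measure[OF C])
  obtain K where K: "\<And>p. p \<in> unit_square \<Longrightarrow> \<bar>f p\<bar> \<le> K" using convex_on_square_bounded[OF f] by blast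
  show ?thesis
  proof (rule integral_dominated_convergence[where w = "\<lambda>_. K"])
    show "f \<in> borel_measurable (copula_measure C)"
      by (rule borel_measurable_convex_on_square[OF C f])
    show "(\<lambda>p. f (contract n p)) \<in> borel_measurable (copula_measure C)" for n
      by (rule borel_measurable_copula_measure(2)[OF C continuous_on_contract[OF f]])
    show "AE p in copula_measure C. (\<lambda>n. f (contract n p)) \<longlonglongrightarrow> f p"
      using AE_copula_measure_interior[OF C]
    proof eventually_elim
      case (elim p)
      have "isCont f p"
        using continuous_on_convex_interior[OF f] elim
        unfolding continuous_on_eq_continuous_at[OF open_Times[OF open_greaterThanLessThan open_greaterThanLessThan]]
        by (rule bspec)
      then show ?case using contract_tendsto by (rule isCont_tendsto_compose)
    qed
    show "AE p in copula_measure C. norm (f (contract n p)) \<le> K" for n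
    proof (rule AE_I2)
      fix p assume "p \<in> space (copula_measure C)"
      then have "contract n p \<in> unit_square"
        using contract_interior[of p n] by (auto simp: space_copula_measure[OF C] mem_Times_iff)
      then show "norm (f (contract n p)) \<le> K" using K by simp
    qed
  qed simp
qed

definition coordinatewise_mono :: "(real \<times> real \<Rightarrow> real) \<Rightarrow> bool" where
  "coordinatewise_mono f \<longleftrightarrow> (\<forall>y\<in>{0..1}. mono_on {0..1} (\<lambda>x. f (x, y))) \<and>
     (\<forall>x\<in>{0..1}. mono_on {0..1} (\<lambda>y. f (x, y)))"

lemma coordinatewise_mono_contract:
  assumes f: "coordinatewise_mono f"
  shows "coordinatewise_mono (\<lambda>p. f (contract n p))"
proof -
  define g where "g x = 1 / real (n + 2) * (1 / 2) + (1 - 1 / real (n + 2)) * x" for x :: real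
  have eq: "contract n (x, y) = (g x, g y)" for x y
    by (simp add: contract_def g_def)
  have g: "g x \<in> {0..1}" if "x \<in> {0..1}" for x
    using contract_interior[of "(x, 0)" n] that by (auto simp: eq)
  have mono: "g x \<le> g y" if "x \<le> y" for x y
    unfolding g_def using that by (intro add_left_mono mult_left_mono) auto
  show ?thesis
    unfolding coordinatewise_mono_def eq
  proof (intro conjI ballI mono_onI)
    fix x x' y :: real
    assume A: "x \<in> {0..1}" "x' \<in> {0..1}" "x \<le> x'" "y \<in> {0..1}"
    have "mono_on {0..1} (\<lambda>x. f (x, g y))" "mono_on {0..1} (\<lambda>x. f (g y, x))"
      using f g[OF A(4)] unfolding coordinatewise_mono_def by blast+
    from this[THEN mono_onD, OF g[OF A(1)] g[OF A(2)] mono[OF A(3)]]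
    show "f (g x, g y) \<le> f (g x', g y)" "f (g y, g x) \<le> f (g y, g x')" .
  qed
qed

definition ordered_by ::
  "(real \<times> real \<Rightarrow> real) set \<Rightarrow> (real \<times> real \<Rightarrow> real) \<Rightarrow> (real \<times> real \<Rightarrow> real) \<Rightarrow> bool" where
  "ordered_by \<Phi> A B \<longleftrightarrow>
     (\<forall>\<phi>\<in>\<Phi>. (\<integral>p. \<phi> p \<partial>copula_measure A) \<le> (\<integral>p. \<phi> p \<partial>copula_measure B))"

text \<open>\<open>P\<close> is the extra constraint on test functions: coordinatewise monotonicity
  for the increasing convex order, a trivial one for the convex order. Contraction preserves
  convexity and \<open>P\<close>, makes the function continuous on the closed square, and its
  integrals converge.\<close>

lemma ordered_by_continuous:
  assumes AB: "A \<in> copulas" "B \<in> copulas"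
    and P: "\<And>f n. P f \<Longrightarrow> P (\<lambda>p. f (contract n p))"
  shows "ordered_by {f. convex_on unit_square f \<and> P f} A B \<longleftrightarrow>
    ordered_by {f. convex_on unit_square f \<and> P f \<and> continuous_on unit_square f} A B"
    (is "?all \<longleftrightarrow> ?cont")
proof
  assume cont: ?cont
  show ?all unfolding ordered_by_def
  proof (intro ballI)
    fix f assume "f \<in> {f. convex_on unit_square f \<and> P f}"
    then have f: "convex_on unit_square f" "P f" by auto
    have "(\<integral>p. f (contract n p) \<partial>copula_measure A) \<le> (\<integral>p. f (contract n p) \<partial>copula_measure B)" for n
      using cont f P convex_on_contract continuous_on_contract by (simp add: ordered_by_def)
    then show "(\<integral>p. f p \<partial>copula_measure A) \<le> (\<integral>p. f p \<partial>copula_measure B)"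
      using integral_contract_tendsto[OF AB(1) f(1)] integral_contract_tendsto[OF AB(2) f(1)]
      by (intro LIMSEQ_le) auto
  qed
qed (auto simp: ordered_by_def)

subsection \<open>The comparability sets\<close>

lemma topspace_copula_pair: "topspace copula_pair_topology = copulas \<times> copulas"
proof -
  interpret Metric_space "copulas \<times> copulas" copula_pair_dist by (rule Metric_space_copula_pairs)
  show ?thesis by (simp add: copula_pair_topology_def)
qed

lemma openin_copula_pair_iff:
  "openin copula_pair_topology U \<longleftrightarrow> U \<subseteq> copulas \<times> copulas \<and>
     (\<forall>(A, B)\<in>U. \<exists>e>0. \<forall>A'\<in>copulas. \<forall>B'\<in>copulas.
        copula_dist A A' < e \<longrightarrow> copula_dist B B' < e \<longrightarrow> (A', B') \<in> U)"
proof -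
  interpret Metric_space "copulas \<times> copulas" copula_pair_dist by (rule Metric_space_copula_pairs)
  have ball: "mball (A, B) e \<subseteq> U \<longleftrightarrow> (\<forall>A'\<in>copulas. \<forall>B'\<in>copulas.
        copula_dist A A' < e \<longrightarrow> copula_dist B B' < e \<longrightarrow> (A', B') \<in> U)"
    if "(A, B) \<in> copulas \<times> copulas" for A B e
  proof -
    have "copula_pair_dist (A, B) (A', B') = max (copula_dist A A') (copula_dist B B')" for A' B'
      by (simp add: copula_pair_dist_def)
    then show ?thesis using that by (auto simp: subset_eq)
  qed
  show ?thesis
    unfolding copula_pair_topology_def openin_mtopology
  proof (rule conj_cong[OF refl])
    assume U: "U \<subseteq> copulas \<times> copulas"
    have "(\<exists>e>0. mball x e \<subseteq> U) \<longleftrightarrow> (case x of (A, B) \<Rightarrow> \<exists>e>0. \<forall>A'\<in>copulas. \<forall>B'\<in>copulas.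
        copula_dist A A' < e \<longrightarrow> copula_dist B B' < e \<longrightarrow> (A', B') \<in> U)" if "x \<in> U" for x
      using ball U that by (cases x) (simp only: prod.case, blast)
    then show "(\<forall>x. x \<in> U \<longrightarrow> (\<exists>e>0. mball x e \<subseteq> U)) \<longleftrightarrow>
        (\<forall>(A, B)\<in>U. \<exists>e>0. \<forall>A'\<in>copulas. \<forall>B'\<in>copulas.
          copula_dist A A' < e \<longrightarrow> copula_dist B B' < e \<longrightarrow> (A', B') \<in> U)"
      by blast
  qed
qed

lemma closedin_integral_le:
  fixes f :: "real \<times> real \<Rightarrow> real"
  assumes f: "continuous_on unit_square f"
  shows "closedin copula_pair_topology {(A, B) \<in> copulas \<times> copulas.
    (\<integral>p. f p \<partial>copula_measure A) \<le> (\<integral>p. f p \<partial>copula_measure B)}"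
proof -
  let ?I = "\<lambda>C. \<integral>p. f p \<partial>copula_measure C"
  let ?S = "{(A, B) \<in> copulas \<times> copulas. ?I A \<le> ?I B}"
  have "\<exists>e>0. \<forall>A'\<in>copulas. \<forall>B'\<in>copulas. copula_dist A A' < e \<longrightarrow> copula_dist B B' < e \<longrightarrow>
      (A', B') \<in> copulas \<times> copulas - ?S"
    if "(A, B) \<in> copulas \<times> copulas - ?S" for A B
  proof -
    have AB: "A \<in> copulas" "B \<in> copulas" and less: "\<not> ?I A \<le> ?I B" using that by auto
    \<comment> \<open>Each of the two integrals may move by less than half of the gap, so the strict
      inequality persists.\<close>
    have half: "0 < (?I A - ?I B) / 2" using less by simp
    obtain \<eta> where \<eta>: "0 < \<eta>" "\<And>C D. C \<in> copulas \<Longrightarrow> D \<in> copulas \<Longrightarrow> copula_dist C D < \<eta> \<Longrightarrow>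
        \<bar>?I C - ?I D\<bar> < (?I A - ?I B) / 2"
      by (rule integral_copula_measure_continuous[OF f half]) (rule that)
    show ?thesis
    proof (intro exI[of _ \<eta>] conjI ballI impI \<eta>(1))
      fix A' B' assume A': "A' \<in> copulas" and B': "B' \<in> copulas"
        and dist: "copula_dist A A' < \<eta>" "copula_dist B B' < \<eta>"
      have "?I B' < ?I A'"
        using \<eta>(2)[OF AB(1) A' dist(1)] \<eta>(2)[OF AB(2) B' dist(2)]
        unfolding abs_less_iff by (simp add: field_simps)
      then show "(A', B') \<in> copulas \<times> copulas - ?S" using A' B' by simp
    qed
  qed
  then have "openin copula_pair_topology (copulas \<times> copulas - ?S)"
    unfolding openin_copula_pair_iff by (intro conjI ballI) (blast, simp only: split_paired_all prod.case)
  then show ?thesis by (auto simp: closedin_def topspace_copula_pair)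
qed

lemma closedin_ordered_by:
  assumes "\<And>f. f \<in> \<Phi> \<Longrightarrow> continuous_on unit_square f" "\<Phi> \<noteq> {}"
  shows "closedin copula_pair_topology {(A, B) \<in> copulas \<times> copulas. ordered_by \<Phi> A B}"
proof -
  have "{(A, B) \<in> copulas \<times> copulas. ordered_by \<Phi> A B} = (\<Inter>f\<in>\<Phi>. {(A, B) \<in> copulas \<times> copulas.
      (\<integral>p. f p \<partial>copula_measure A) \<le> (\<integral>p. f p \<partial>copula_measure B)})"
    using assms(2) by (auto simp: ordered_by_def)
  moreover have "closedin copula_pair_topology \<dots>"
    by (rule closedin_INT[OF assms(2) closedin_integral_le[OF assms(1)]])
  ultimately show ?thesis by simp
qed

lemma closedin_comparability_set:
  assumes \<Phi>: "\<And>f. f \<in> \<Phi> \<Longrightarrow> continuous_on unit_square f" "\<Phi> \<noteq> {}"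
    and le: "\<And>A B. A \<in> copulas \<Longrightarrow> B \<in> copulas \<Longrightarrow> le A B \<longleftrightarrow> ordered_by \<Phi> A B"
  shows "closedin copula_pair_topology (comparability_set le)"
proof -
  \<comment> \<open>Negating the test functions reverses the order, so the reversed relation is
    again of the form \<open>ordered_by\<close> with continuous test functions.\<close>
  define \<Psi> where "\<Psi> = (\<lambda>f p. - f p) ` \<Phi>"
  have "ordered_by \<Psi> A B \<longleftrightarrow> ordered_by \<Phi> B A" for A B
    by (simp add: ordered_by_def \<Psi>_def)
  then have "comparability_set le = {(A, B) \<in> copulas \<times> copulas. ordered_by \<Phi> A B} \<union>
      {(A, B) \<in> copulas \<times> copulas. ordered_by \<Psi> A B}"
    using le by (auto simp: comparability_set_def)
  moreover have "closedin copula_pair_topology \<dots>"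
  proof (intro closedin_Un closedin_ordered_by)
    show "continuous_on unit_square f" if "f \<in> \<Psi>" for f
      using that \<Phi>(1) by (auto simp: \<Psi>_def intro: continuous_on_minus)
  qed (use \<Phi> in \<open>auto simp: \<Psi>_def\<close>)
  ultimately show ?thesis by simp
qed

lemma continuous_on_stop_loss_kernel:
  "continuous_on S (\<lambda>p :: real \<times> real. max (fst p + snd p - t) 0)"
  by (intro continuous_intros)

lemma convex_on_stop_loss_kernel:
  "convex_on unit_square (\<lambda>p :: real \<times> real. max (fst p + snd p - t) 0)"
proof (rule convex_onI)
  show "convex unit_square" by (intro convex_Times) auto
  fix s :: real and p q :: "real \<times> real" assume s: "0 < s" "s < 1"
  let ?h = "\<lambda>p :: real \<times> real. fst p + snd p - t"
  have "?h ((1 - s) *\<^sub>R p + s *\<^sub>R q) = (1 - s) * ?h p + s * ?h q" by (simp add: algebra_simps)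
  also have "\<dots> \<le> (1 - s) * max (?h p) 0 + s * max (?h q) 0"
    using s by (intro add_mono mult_left_mono) auto
  finally show "max (?h ((1 - s) *\<^sub>R p + s *\<^sub>R q)) 0 \<le> (1 - s) * max (?h p) 0 + s * max (?h q) 0"
    using s by simp
qed

lemma coordinatewise_mono_stop_loss_kernel: "coordinatewise_mono (\<lambda>p. max (fst p + snd p - t) 0)"
  by (auto simp: coordinatewise_mono_def mono_on_def)

text \<open>The conjunct \<open>True\<close> brings the convex order into the shape of
  \<open>ordered_by_continuous\<close>.\<close>

lemma le_cx_iff: "le_cx A B \<longleftrightarrow> ordered_by {f. convex_on unit_square f \<and> True} A B"
  by (simp add: le_cx_def ordered_by_def)

lemma le_icx_iff: "le_icx A B \<longleftrightarrow> ordered_by {f. convex_on unit_square f \<and> coordinatewise_mono f} A B"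
  by (auto simp: le_icx_def ordered_by_def coordinatewise_mono_def)

lemma le_sl_iff_ordered_by:
  "le_sl A B \<longleftrightarrow> ordered_by (range (\<lambda>t p. max (fst p + snd p - t) 0)) A B"
  by (auto simp: le_sl_iff ordered_by_def stop_loss_def)

lemma closedin_comparability_sets:
  assumes "le \<in> {le_icx, le_cx, le_sl}"
  shows "closedin copula_pair_topology (comparability_set le)"
proof -
  let ?\<Phi> = "\<lambda>P. {f. convex_on unit_square f \<and> P f \<and> continuous_on unit_square f}"
  have ne: "?\<Phi> P \<noteq> {}" if "P (\<lambda>p. max (fst p + snd p - 0) 0)" for P
    using that convex_on_stop_loss_kernel[of 0] continuous_on_stop_loss_kernel[of unit_square 0] by blast
  have "closedin copula_pair_topology (comparability_set le_icx)"
  proof (rule closedin_comparability_set)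
    show "?\<Phi> coordinatewise_mono \<noteq> {}"
      by (rule ne[of coordinatewise_mono, OF coordinatewise_mono_stop_loss_kernel[of 0]])
    show "le_icx A B \<longleftrightarrow> ordered_by (?\<Phi> coordinatewise_mono) A B" if "A \<in> copulas" "B \<in> copulas" for A B
      unfolding le_icx_iff by (rule ordered_by_continuous[OF that coordinatewise_mono_contract])
  qed simp
  moreover have "closedin copula_pair_topology (comparability_set le_cx)"
  proof (rule closedin_comparability_set)
    show "?\<Phi> (\<lambda>_. True) \<noteq> {}" by (rule ne) simp
    show "le_cx A B \<longleftrightarrow> ordered_by (?\<Phi> (\<lambda>_. True)) A B" if "A \<in> copulas" "B \<in> copulas" for A B
      unfolding le_cx_iff by (rule ordered_by_continuous[OF that])
  qed simp
  moreover have "closedin copula_pair_topology (comparability_set le_sl)"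
    by (rule closedin_comparability_set[OF _ _ le_sl_iff_ordered_by])
      (auto intro: continuous_on_stop_loss_kernel)
  ultimately show ?thesis using assms by blast
qed

section \<open>Reduction of all orders to the stop-loss order, and genericity\<close>

lemma le_icx_imp_le_sl: "le_icx A B \<Longrightarrow> le_sl A B"
  by (auto simp: le_icx_iff le_sl_iff_ordered_by ordered_by_def convex_on_stop_loss_kernel
      coordinatewise_mono_stop_loss_kernel)

lemma le_cx_imp_le_sl: "le_cx A B \<Longrightarrow> le_sl A B"
  by (auto simp: le_cx_iff le_sl_iff_ordered_by ordered_by_def convex_on_stop_loss_kernel)

text \<open>The kernel is a convex function of \<open>x + y\<close>: the sums at the minimum and the
  maximum have the same total as the given two sums and are spread further apart. Integrability is a
  premise inside \<open>le_sm\<close> and is supplied by boundedness on the square.\<close>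

lemma le_sm_imp_le_sl:
  assumes AB: "A \<in> copulas" "B \<in> copulas" and sm: "le_sm A B"
  shows "le_sl A B"
proof -
  have "supermodular (\<lambda>p. max (fst p + snd p - t) 0)" for t
    unfolding supermodular_def by (auto simp: min_def max_def)
  moreover have "integrable (copula_measure C) (\<lambda>p. max (fst p + snd p - t) 0)" if C: "C \<in> copulas" for C t
  proof -
    interpret prob_space "copula_measure C" by (rule prob_space_copula_measure[OF C])
    show ?thesis
      by (rule integrable_const_bound[where B = "2 + \<bar>t\<bar>"])
        (auto simp: space_copula_measure[OF C] intro!: AE_I2
          borel_measurable_copula_measure(2)[OF C] continuous_on_stop_loss_kernel)
  qed
  ultimately show ?thesis
    using sm AB by (auto simp: le_sm_def le_sl_iff_ordered_by ordered_by_def)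
qed

lemma comparability_set_subset_sl:
  assumes "le \<in> {le_icx, le_cx, le_sl, le_lo, le_sm}"
  shows "comparability_set le \<subseteq> comparability_set le_sl"
  using assms le_icx_imp_le_sl le_cx_imp_le_sl le_sm_imp_le_sl le_lo_imp_le_sl
  by (auto simp: comparability_set_def)

lemma interior_comparability_set_sl:
  "copula_pair_topology interior_of comparability_set le_sl = {}"
proof -
  have "(A, B) \<notin> U" if U: "openin copula_pair_topology U" "U \<subseteq> comparability_set le_sl" for A B U
  proof
    assume "(A, B) \<in> U"
    then obtain e where AB: "A \<in> copulas" "B \<in> copulas" and e: "0 < e"
      "\<And>A' B'. A' \<in> copulas \<Longrightarrow> B' \<in> copulas \<Longrightarrow> copula_dist A A' < e \<Longrightarrow> copula_dist B B' < e \<Longrightarrow> (A', B') \<in> U"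
      using U(1) unfolding openin_copula_pair_iff by blast
    \<comment> \<open>Bounding by \<open>e / 7\<close> turns the distance \<open>6 * d\<close> of
      the patched copulas into less than \<open>e\<close>; \<open>1 / 4\<close> keeps the two
      corners apart.\<close>
    define d where "d = min (1 / 4) (e / 7)"
    have d: "0 < d" "d < 1 / 2" "6 * d < e" using e(1) by (auto simp: d_def min_def)
    let ?A = "corner_patch d comonotone_copula A countermonotone_copula"
    let ?B = "corner_patch d countermonotone_copula B comonotone_copula"
    have "(?A, ?B) \<in> U"
    proof (rule e(2))
      show "?A \<in> copulas" "?B \<in> copulas"
        using d AB by (simp_all add: corner_patch_copula comonotone_copula countermonotone_copula)
      show "copula_dist A ?A < e" "copula_dist B ?B < e"
        using copula_dist_corner_patch[OF d(1,2) comonotone_copula AB(1) countermonotone_copula]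
          copula_dist_corner_patch[OF d(1,2) countermonotone_copula AB(2) comonotone_copula] d(3)
        by linarith+
    qed
    then show False
      using U(2) corner_patches_incomparable[OF d(1,2) AB] by (auto simp: comparability_set_def)
  qed
  then show ?thesis unfolding interior_of_def by fastforce
qed

text \<open>The closure is bounded by the closed stop-loss set rather than computed, which treats
  the lower orthant and supermodular orders on the same footing as the three closed ones.\<close>

lemma nowhere_dense_comparability_set:
  assumes "le \<in> {le_icx, le_cx, le_sl, le_lo, le_sm}"
  shows "nowhere_dense_in copula_pair_topology (comparability_set le)"
proof -
  have "copula_pair_topology closure_of comparability_set le \<subseteq> comparability_set le_sl"
    using comparability_set_subset_sl[OF assms] closedin_comparability_sets[of le_sl]
    by (intro closure_of_minimal) auto
  then have "copula_pair_topology interior_of (copula_pair_topology closure_of comparability_set le) = {}"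
    using interior_of_mono interior_comparability_set_sl by (metis subset_empty)
  moreover have "comparability_set le \<subseteq> copulas \<times> copulas" by (auto simp: comparability_set_def)
  ultimately show ?thesis by (simp add: nowhere_dense_in_def topspace_copula_pair)
qed

lemma comeager_incomparable:
  assumes L: "L \<subseteq> {le_icx, le_cx, le_sl, le_lo, le_sm}"
  shows "comeager_in copula_pair_topology (copulas \<times> copulas - (\<Union>le\<in>L. comparability_set le))"
proof -
  have sub: "(\<Union>le\<in>L. comparability_set le) \<subseteq> copulas \<times> copulas"
    by (auto simp: comparability_set_def)
  have "countable (comparability_set ` L)"
    using finite_subset[OF L] by (intro countable_finite finite_imageI) simp
  then have "meager_in copula_pair_topology (\<Union>le\<in>L. comparability_set le)"
    unfolding meager_in_def using L nowhere_dense_comparability_set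
    by (intro exI[of _ "comparability_set ` L"]) blast
  then show ?thesis
    using sub by (simp add: comeager_in_def topspace_copula_pair double_diff)
qed

theorem theorem11:
  shows "(\<forall>le\<in>{le_icx, le_cx, le_sl}.
            closedin copula_pair_topology (comparability_set le) \<and>
            nowhere_dense_in copula_pair_topology (comparability_set le) \<and>
            openin copula_pair_topology (copulas \<times> copulas - comparability_set le) \<and>
            comeager_in copula_pair_topology (copulas \<times> copulas - comparability_set le)) \<and>
         comeager_in copula_pair_topology
           (copulas \<times> copulas -
             (comparability_set le_icx \<union> comparability_set le_cx \<union> comparability_set le_sl)) \<and>
         comeager_in copula_pair_topology
           {(A, B) \<in> copulas \<times> copulas.
              \<forall>le\<in>{le_icx, le_cx, le_sl, le_lo, le_sm}. \<not> le A B \<and> \<not> le B A}"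
proof (intro conjI ballI)
  fix le assume le: "le \<in> {le_icx, le_cx, le_sl}"
  show "closedin copula_pair_topology (comparability_set le)"
    by (rule closedin_comparability_sets[OF le])
  then show "openin copula_pair_topology (copulas \<times> copulas - comparability_set le)"
    by (simp add: closedin_def topspace_copula_pair)
  show "nowhere_dense_in copula_pair_topology (comparability_set le)"
    using le by (intro nowhere_dense_comparability_set) blast
  show "comeager_in copula_pair_topology (copulas \<times> copulas - comparability_set le)"
    using comeager_incomparable[of "{le}"] le by auto
next
  show "comeager_in copula_pair_topology (copulas \<times> copulas -
      (comparability_set le_icx \<union> comparability_set le_cx \<union> comparability_set le_sl))"
    using comeager_incomparable[of "{le_icx, le_cx, le_sl}"] by (simp add: Un_assoc)
next
  have "{(A, B) \<in> copulas \<times> copulas. \<forall>le\<in>{le_icx, le_cx, le_sl, le_lo, le_sm}. \<not> le A B \<and> \<not> le B A} =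
      copulas \<times> copulas - (\<Union>le\<in>{le_icx, le_cx, le_sl, le_lo, le_sm}. comparability_set le)"
    by (auto simp: comparability_set_def)
  then show "comeager_in copula_pair_topology
      {(A, B) \<in> copulas \<times> copulas. \<forall>le\<in>{le_icx, le_cx, le_sl, le_lo, le_sm}. \<not> le A B \<and> \<not> le B A}"
    using comeager_incomparable[of "{le_icx, le_cx, le_sl, le_lo, le_sm}"] by simp
qed

end
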